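(* Let $\gamma\ge 1$, $a>0$, $\beta>0$, and consider the stationary parallel slow MHD shocks with fixed gas-dynamical part $(\rho^\pm,u_1^\pm)$, $\rho^\pm>0$, $0<u_1^+<u_1^-$, satisfying $[\rho u_1]=0$ and $[\rho u_1^2+a\rho^\gamma]=0$, with $u_2^\pm=h_2^\pm=0$ and $h_1^+=h_1^-=\bar h_1=1/\varepsilon$. Set $R=\rho^+/\rho^-=u_1^-/u_1^+>1$ and let $M>0$ be given by $M^2=\frac{(u_1^+)^2}{a\gamma(\rho^+)^{\gamma-1}}=\frac{R^\gamma-1}{\gamma R^\gamma(R-1)}$. Then, as $\varepsilon\to0^+$ (infinite magnetic field limit), the Lopatinsky determinant $\Delta^{(\varepsilon)}(\lambda,1)$ (with $\xi=1$) of the shock has a root $\lambda=\lambda(\varepsilon)$ satisfying $$\lambda(\varepsilon)=\lambda_2\varepsilon^2+O(\varepsilon^3),\qquad \lambda_2=\frac{(R-1)\,M\,R^2\,\rho^-(u_1^+)^3}{2(M+1)}>0 .$$ In particular, for every $\gamma\ge1$ these slow shocks are unstable (the Lopatinsky determinant vanishes at some $\lambda$ with $\mathrm{Re}\,\lambda>0$) for all sufficiently large magnetic field $\bar h_1$.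
   Context: Notation: $[g]=g^+-g^-$ is the jump across $x_1=0$. With $W=(\rho,u_1,u_2,h_1,h_2)^T$, $p(\rho)=a\rho^\gamma$, the inviscid isentropic 2-D MHD $\beta$-model is $f_0(W)_t+f_1(W)_{x_1}+f_2(W)_{x_2}=0$, where $f_0=(\rho,\rho u_1,\rho u_2,h_1,h_2)^T$, $f_1=(\rho u_1,\ \rho u_1^2+\tfrac12(h_2^2-h_1^2)+p,\ \rho u_1u_2-h_1h_2,\ \beta h_1,\ u_1h_2-h_1u_2)^T$, $f_2=(\rho u_2,\ \rho u_1u_2-h_1h_2,\ \rho u_2^2+\tfrac12(h_1^2-h_2^2)+p,\ \beta h_2+h_1u_2-h_2u_1,\ 0)^T$. The shock is $W=W^\pm=(\rho^\pm,u_1^\pm,0,\bar h_1,0)$ for $x_1\gtrless0$, a stationary weak solution. It is called slow when $|\bar h_1|>H^*:=u_1^-\sqrt{\rho^-}$. Put $A_j^\pm=Df_j(W^\pm)$. For $\mathrm{Re}\,\lambda>0$ and $\xi\in\mathbb R$, consider the Laplace–Fourier transformed linearized equations $v_{x_1}=-(A_1^\pm)^{-1}(\lambda A_0^\pm+i\xi A_2^\pm)v$ on $x_1\gtrless0$, and let $\mathcal E^\pm(\lambda,\xi)$ denote bases of the spaces of (values at $x_1=0$ of) solutions decaying as $x_1\to\pm\infty$. The dimensions of these spaces add up to $4$. The Lopatinsky determinant is $$\Delta(\lambda,\xi)=\det\bigl(A_1^+\mathcal E^+,\ A_1^-\mathcal E^-,\ \lambda[f_0]+i\xi[f_2]\bigr)\big|_{x_1=0}.$$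 $\Delta^{(\varepsilon)}$ denotes this determinant for the shock with $\bar h_1=1/\varepsilon$. *)

theory Defs
  imports "HOL-Analysis.Analysis" "HOL-Library.Landau_Symbols"
begin

text \<open>States are \<open>W = (\<rho>, u\<^sub>1, u\<^sub>2, h\<^sub>1, h\<^sub>2)\<close>, with components indexed by the numeral
  type \<open>5\<close>; \<open>vector [x\<^sub>1, \<dots>, x\<^sub>5]\<close> places \<open>x\<^sub>k\<close> at index \<open>k\<close>.\<close>

definition pressure :: "real \<Rightarrow> real \<Rightarrow> real \<Rightarrow> real" where
  "pressure a \<gamma> \<rho> = a * \<rho> powr \<gamma>"

definition flux0 :: "real^5 \<Rightarrow> real^5" where
  "flux0 W = (let \<rho> = W$1; u1 = W$2; u2 = W$3; h1 = W$4; h2 = W$5 in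
     vector [\<rho>, \<rho> * u1, \<rho> * u2, h1, h2])"

definition flux1 :: "real \<Rightarrow> real \<Rightarrow> real \<Rightarrow> real^5 \<Rightarrow> real^5" where
  "flux1 a \<gamma> \<beta> W = (let \<rho> = W$1; u1 = W$2; u2 = W$3; h1 = W$4; h2 = W$5 in
     vector [\<rho> * u1,
             \<rho> * u1^2 + (h2^2 - h1^2) / 2 + pressure a \<gamma> \<rho>,
             \<rho> * u1 * u2 - h1 * h2,
             \<beta> * h1,
             u1 * h2 - h1 * u2])"

definition flux2 :: "real \<Rightarrow> real \<Rightarrow> real \<Rightarrow> real^5 \<Rightarrow> real^5" where
  "flux2 a \<gamma> \<beta> W = (let \<rho> = W$1; u1 = W$2; u2 = W$3; h1 = W$4; h2 = W$5 in
     vector [\<rho> * u2,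
             \<rho> * u1 * u2 - h1 * h2,
             \<rho> * u2^2 + (h1^2 - h2^2) / 2 + pressure a \<gamma> \<rho>,
             \<beta> * h2 + h1 * u2 - h2 * u1,
             0])"

definition parallel_state :: "real \<Rightarrow> real \<Rightarrow> real \<Rightarrow> real^5" where
  "parallel_state \<rho> u h = vector [\<rho>, u, 0, h, 0]"

definition slow_field :: "real \<Rightarrow> real \<Rightarrow> real \<Rightarrow> bool" where
  "slow_field \<rho>m um h \<longleftrightarrow> \<bar>h\<bar> > um * sqrt \<rho>m"

definition cvec :: "real^5 \<Rightarrow> complex^5" where
  "cvec v = (\<chi> i. complex_of_real (v $ i))"

definition cmat :: "real^5^5 \<Rightarrow> complex^5^5" where
  "cmat A = (\<chi> i j. complex_of_real (A $ i $ j))"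

definition A0 :: "real^5 \<Rightarrow> complex^5^5" where
  "A0 W = cmat (jacobian flux0 (at W))"

definition A1 :: "real \<Rightarrow> real \<Rightarrow> real \<Rightarrow> real^5 \<Rightarrow> complex^5^5" where
  "A1 a \<gamma> \<beta> W = cmat (jacobian (flux1 a \<gamma> \<beta>) (at W))"

definition A2 :: "real \<Rightarrow> real \<Rightarrow> real \<Rightarrow> real^5 \<Rightarrow> complex^5^5" where
  "A2 a \<gamma> \<beta> W = cmat (jacobian (flux2 a \<gamma> \<beta>) (at W))"

text \<open>The matrix of the transformed linearized equations \<open>v' = G v\<close>;
  \<open>mat c ** A\<close> is the multiple of \<open>A\<close> by the scalar \<open>c\<close>.\<close>

definition symbol_matrix ::
  "real \<Rightarrow> real \<Rightarrow> real \<Rightarrow> real^5 \<Rightarrow> complex \<Rightarrow> real \<Rightarrow> complex^5^5" where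
  "symbol_matrix a \<gamma> \<beta> W lam \<xi> =
     - (matrix_inv (A1 a \<gamma> \<beta> W) **
         (mat lam ** A0 W + mat (\<i> * complex_of_real \<xi>) ** A2 a \<gamma> \<beta> W))"

definition decaying_right :: "complex^5^5 \<Rightarrow> (complex^5) set" where
  "decaying_right G = {v 0 | v :: real \<Rightarrow> complex^5.
     (\<forall>x\<ge>0. (v has_vector_derivative (G *v v x)) (at x within {0..})) \<and> (v \<longlongrightarrow> 0) at_top}"

definition decaying_left :: "complex^5^5 \<Rightarrow> (complex^5) set" where
  "decaying_left G = {v 0 | v :: real \<Rightarrow> complex^5.
     (\<forall>x\<le>0. (v has_vector_derivative (G *v v x)) (at x within {..0})) \<and> (v \<longlongrightarrow> 0) at_bot}"

text \<open>Spans, independence and dimension are over the complex numbers.\<close>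

definition is_basis :: "(complex^5) list \<Rightarrow> (complex^5) set \<Rightarrow> bool" where
  "is_basis E S \<longleftrightarrow> distinct E \<and> vec.independent (set E) \<and> vec.span (set E) = S"

text \<open>The five columns of the determinant are listed in order, hence the transpose; the value is
  meaningful only if \<open>length Ep + length Em = 4\<close>.\<close>

definition lopatinsky_det ::
  "real \<Rightarrow> real \<Rightarrow> real \<Rightarrow> real^5 \<Rightarrow> real^5 \<Rightarrow> (complex^5) list \<Rightarrow> (complex^5) list
     \<Rightarrow> complex \<Rightarrow> real \<Rightarrow> complex" where
  "lopatinsky_det a \<gamma> \<beta> Wm Wp Ep Em lam \<xi> =
     det (transpose (vector
       (map ((*v) (A1 a \<gamma> \<beta> Wp)) Ep @ map ((*v) (A1 a \<gamma> \<beta> Wm)) Em @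
        [lam *s cvec (flux0 Wp - flux0 Wm) +
         (\<i> * complex_of_real \<xi>) *s cvec (flux2 a \<gamma> \<beta> Wp - flux2 a \<gamma> \<beta> Wm)]) :: complex^5^5))"

text \<open>Vanishing of the determinant does not depend on the bases, so a root is required to be one
  for every choice; bases exist by \<open>ex_basis_right\<close> and \<open>ex_basis_left\<close> below.\<close>

definition lopatinsky_root ::
  "real \<Rightarrow> real \<Rightarrow> real \<Rightarrow> real^5 \<Rightarrow> real^5 \<Rightarrow> complex \<Rightarrow> real \<Rightarrow> bool" where
  "lopatinsky_root a \<gamma> \<beta> Wm Wp lam \<xi> \<longleftrightarrow>
     (let Sp = decaying_right (symbol_matrix a \<gamma> \<beta> Wp lam \<xi>);
          Sm = decaying_left (symbol_matrix a \<gamma> \<beta> Wm lam \<xi>)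
      in 0 < Re lam \<and> vec.dim Sp + vec.dim Sm = 4 \<and>
         (\<forall>Ep Em. is_basis Ep Sp \<and> is_basis Em Sm \<longrightarrow>
            lopatinsky_det a \<gamma> \<beta> Wm Wp Ep Em lam \<xi> = 0))"

lemma bounded_linear_vector_scale: "bounded_linear (\<lambda>x. c *s (x :: complex^5))"
proof (rule linear_conv_bounded_linear[THEN iffD1])
  show "linear (\<lambda>x. c *s (x :: complex^5))"
    by (rule linearI) (simp_all only: vec_eq_iff vector_smult_component vector_add_component
        vector_scaleR_component distrib_left mult_scaleR_right simp_thms)
qed

lemma decaying_rightI:
  assumes "\<And>x. x \<ge> 0 \<Longrightarrow> (v has_vector_derivative (G *v v x)) (at x within {0..})"
    and "(v \<longlongrightarrow> 0) at_top"
  shows "v 0 \<in> decaying_right G"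
  using assms unfolding decaying_right_def by blast

lemma subspace_decaying_right: "vec.subspace (decaying_right G)"
proof (rule vec.subspaceI)
  show "0 \<in> decaying_right G"
    by (rule decaying_rightI[where v = "\<lambda>_. 0"])
      (simp_all only: matrix_vector_mult_0_right has_vector_derivative_const tendsto_const)
next
  fix y z assume y: "y \<in> decaying_right G" and z: "z \<in> decaying_right G"
  from y obtain v where v: "y = v 0"
    "\<forall>x\<ge>0. (v has_vector_derivative (G *v v x)) (at x within {0..})" "(v \<longlongrightarrow> 0) at_top"
    unfolding decaying_right_def by blast
  from z obtain w where w: "z = w 0"
    "\<forall>x\<ge>0. (w has_vector_derivative (G *v w x)) (at x within {0..})" "(w \<longlongrightarrow> 0) at_top"
    unfolding decaying_right_def by blast
  show "y + z \<in> decaying_right G"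
    unfolding v(1) w(1)
  proof (rule decaying_rightI[where v = "\<lambda>x. v x + w x"])
    show "((\<lambda>x. v x + w x) has_vector_derivative (G *v (v x + w x))) (at x within {0..})"
      if "x \<ge> 0" for x
      unfolding matrix_vector_right_distrib
      by (intro has_vector_derivative_add v(2)[rule_format, OF that] w(2)[rule_format, OF that])
    show "((\<lambda>x. v x + w x) \<longlongrightarrow> 0) at_top"
      by (rule tendsto_add_zero[OF v(3) w(3)])
  qed
next
  fix c y assume "y \<in> decaying_right G"
  then obtain v where v: "y = v 0"
    "\<forall>x\<ge>0. (v has_vector_derivative (G *v v x)) (at x within {0..})" "(v \<longlongrightarrow> 0) at_top"
    unfolding decaying_right_def by blast
  show "c *s y \<in> decaying_right G"
    unfolding v(1)
  proof (rule decaying_rightI[where v = "\<lambda>x. c *s v x"])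
    show "((\<lambda>x. c *s v x) has_vector_derivative (G *v (c *s v x))) (at x within {0..})"
      if "x \<ge> 0" for x
      unfolding vector_scalar_commute
      by (rule bounded_linear.has_vector_derivative[OF bounded_linear_vector_scale
            v(2)[rule_format, OF that]])
    show "((\<lambda>x. c *s v x) \<longlongrightarrow> 0) at_top"
      by (rule bounded_linear.tendsto_zero[OF bounded_linear_vector_scale v(3)])
  qed
qed

lemma decaying_leftI:
  assumes "\<And>x. x \<le> 0 \<Longrightarrow> (v has_vector_derivative (G *v v x)) (at x within {..0})"
    and "(v \<longlongrightarrow> 0) at_bot"
  shows "v 0 \<in> decaying_left G"
  using assms unfolding decaying_left_def by blast

lemma subspace_decaying_left: "vec.subspace (decaying_left G)"
proof (rule vec.subspaceI)
  show "0 \<in> decaying_left G"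
    by (rule decaying_leftI[where v = "\<lambda>_. 0"])
      (simp_all only: matrix_vector_mult_0_right has_vector_derivative_const tendsto_const)
next
  fix y z assume y: "y \<in> decaying_left G" and z: "z \<in> decaying_left G"
  from y obtain v where v: "y = v 0"
    "\<forall>x\<le>0. (v has_vector_derivative (G *v v x)) (at x within {..0})" "(v \<longlongrightarrow> 0) at_bot"
    unfolding decaying_left_def by blast
  from z obtain w where w: "z = w 0"
    "\<forall>x\<le>0. (w has_vector_derivative (G *v w x)) (at x within {..0})" "(w \<longlongrightarrow> 0) at_bot"
    unfolding decaying_left_def by blast
  show "y + z \<in> decaying_left G"
    unfolding v(1) w(1)
  proof (rule decaying_leftI[where v = "\<lambda>x. v x + w x"])
    show "((\<lambda>x. v x + w x) has_vector_derivative (G *v (v x + w x))) (at x within {..0})"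
      if "x \<le> 0" for x
      unfolding matrix_vector_right_distrib
      by (intro has_vector_derivative_add v(2)[rule_format, OF that] w(2)[rule_format, OF that])
    show "((\<lambda>x. v x + w x) \<longlongrightarrow> 0) at_bot"
      by (rule tendsto_add_zero[OF v(3) w(3)])
  qed
next
  fix c y assume "y \<in> decaying_left G"
  then obtain v where v: "y = v 0"
    "\<forall>x\<le>0. (v has_vector_derivative (G *v v x)) (at x within {..0})" "(v \<longlongrightarrow> 0) at_bot"
    unfolding decaying_left_def by blast
  show "c *s y \<in> decaying_left G"
    unfolding v(1)
  proof (rule decaying_leftI[where v = "\<lambda>x. c *s v x"])
    show "((\<lambda>x. c *s v x) has_vector_derivative (G *v (c *s v x))) (at x within {..0})"
      if "x \<le> 0" for x
      unfolding vector_scalar_commute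
      by (rule bounded_linear.has_vector_derivative[OF bounded_linear_vector_scale
            v(2)[rule_format, OF that]])
    show "((\<lambda>x. c *s v x) \<longlongrightarrow> 0) at_bot"
      by (rule bounded_linear.tendsto_zero[OF bounded_linear_vector_scale v(3)])
  qed
qed

lemma ex_basis:
  assumes "vec.subspace S"
  shows "\<exists>E. is_basis E S"
proof -
  obtain B where B: "B \<subseteq> S" "vec.independent B" "S \<subseteq> vec.span B"
    by (rule vec.basis_exists[of S])
  obtain E where E: "set E = B" "distinct E"
    using finite_distinct_list[OF vec.finiteI_independent[OF B(2)]] by (elim exE conjE)
  have "vec.span B = S"
    by (rule subset_antisym[OF vec.span_minimal[OF B(1) assms] B(3)])
  then have "is_basis E S"
    unfolding is_basis_def E(1) using B(2) E(2) by (intro conjI)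
  then show ?thesis
    by (rule exI)
qed

lemma ex_basis_right: "\<exists>E. is_basis E (decaying_right G)"
  by (rule ex_basis[OF subspace_decaying_right])

lemma ex_basis_left: "\<exists>E. is_basis E (decaying_left G)"
  by (rule ex_basis[OF subspace_decaying_left])

end

theory Submission
  imports Defs
begin

text \<open>Write \<open>s = lam + \<mu> u\<close>, \<open>C\<close> for the squared sound speed and \<open>P = s\<^sup>2 - C \<mu>\<^sup>2\<close>. Besides the
  exponent \<open>- lam / \<beta>\<close>, which carries the divergence of the magnetic field, the exponents \<open>\<mu>\<close> are the
  roots of \<open>(\<rho> s\<^sup>2 + h\<^sup>2 (1 - \<mu>\<^sup>2)) P + \<rho> C s\<^sup>2 = 0\<close>: for \<open>h \<rightarrow> \<infinity>\<close> two lie near \<open>\<plusminus>1\<close> and two near the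
  acoustic values \<open>lam / (\<plusminus>c - u)\<close>. Sign changes of this quartic give all five exponents, so
  the decaying spaces have dimensions 3 and 1. The determinant vanishes once the jump vector
  is a combination of the divergence-free decaying modes, with exponents near \<open>-1\<close> and
  \<open>- lam / (u + c)\<close> on the right and near \<open>1\<close> on the left.

  With \<open>e = \<epsilon>\<^sup>2\<close>, \<open>lam = e l\<close> and the second exponent written as \<open>lam y\<close>, the three dispersion relations
  and the vanishing of the determinant take the form \<open>p = p0 + e g(e, p)\<close> with \<open>g\<close> continuous
  for the real unknowns \<open>p = (x, y, w, l)\<close>. Brouwer's theorem on a small ball gives a solution with
  \<open>p = p0 + O(e)\<close>, and \<open>lam2\<close> is the last entry of \<open>p0\<close>.\<close>

section \<open>Linearization at a parallel state\<close>

text \<open>The scale \<open>lam = O(e)\<close> is forced by the jump vector. Its only nonzero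
  entries are \<open>lam [\<rho>]\<close> in the mass row and \<open>\<i> [p]\<close> in the
  transverse momentum row. The modes contribute terms of order 1 to the first row and of order
  \<open>h\<^sup>2\<close> to the second, so eliminating the coefficient of the jump vector leaves
  \<open>lam h\<^sup>2 = l\<close> as the natural unknown. The acoustic exponent tends to 0 together
  with \<open>lam\<close>, and its mode degenerates. Dividing this exponent by \<open>lam\<close>
  and the mode entries by the matching powers of \<open>lam\<close> gives a regular limit. Real
  unknowns suffice because the exponents are real and each component of a mode has a fixed phase.
  The divergence mode may take coefficient 0: the other modes and the jump vector obey one common
  linear relation between rows 4 and 5, so five rows impose only four conditions. Since the fixed
  point map is constant at \<open>e = 0\<close>, continuity is enough and no Jacobian has to be
  inverted. The error obtained is O(\<epsilon>^4), sharper than required.\<close>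

lemma exhaust_5: fixes x :: 5 shows "x = 1 \<or> x = 2 \<or> x = 3 \<or> x = 4 \<or> x = 5"
proof (induct x)
  case (of_int z)
  then have "z = 0 \<or> z = 1 \<or> z = 2 \<or> z = 3 \<or> z = 4" by simp linarith
  then show ?case by auto
qed

lemma forall_5: "(\<forall>i::5. P i) \<longleftrightarrow> P 1 \<and> P 2 \<and> P 3 \<and> P 4 \<and> P 5"
  by (metis exhaust_5)

lemma UNIV_5: "UNIV = {1, 2, 3, 4, 5::5}"
  using exhaust_5 by auto

lemma sum_5: "sum f (UNIV::5 set) = f 1 + f 2 + f 3 + f 4 + f 5"
  unfolding UNIV_5 by (simp add: ac_simps)

lemma vector_5:
  "(vector [v1, v2, v3, v4, v5] :: ('a::zero)^5) $ 1 = v1"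
  "(vector [v1, v2, v3, v4, v5] :: ('a::zero)^5) $ 2 = v2"
  "(vector [v1, v2, v3, v4, v5] :: ('a::zero)^5) $ 3 = v3"
  "(vector [v1, v2, v3, v4, v5] :: ('a::zero)^5) $ 4 = v4"
  "(vector [v1, v2, v3, v4, v5] :: ('a::zero)^5) $ 5 = v5"
  unfolding vector_def by simp_all

lemma has_derivative_vec_componentwise:
  fixes f :: "'a::real_normed_vector \<Rightarrow> real^'n"
  shows "(f has_derivative f') (at x within S)
    \<longleftrightarrow> (\<forall>i. ((\<lambda>x. f x $ i) has_derivative (\<lambda>x. f' x $ i)) (at x within S))"
  by (subst has_derivative_componentwise_within)
     (auto simp: Basis_vec_def inner_axis)

lemma has_derivative_vec_nth: "((\<lambda>x::real^'n. x $ i) has_derivative (\<lambda>x. x $ i)) F"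
  by (rule bounded_linear_imp_has_derivative[OF bounded_linear_vec_nth])

lemma jacobian_eqI:
  fixes f :: "real^'n \<Rightarrow> real^'m"
  assumes "(f has_derivative (\<lambda>x. M *v x)) (at W)"
  shows "jacobian f (at W) = M"
proof -
  have "frechet_derivative f (at W) = (\<lambda>x. M *v x)"
    using frechet_derivative_at[OF assms] by simp
  then show ?thesis by (simp add: jacobian_def matrix_of_matrix_vector_mul)
qed

lemma matrix_vector_mult_5:
  "((vector [r1, r2, r3, r4, r5] :: ('a::semiring_1)^5^5) *v x) $ 1 = (\<Sum>j\<in>UNIV. r1 $ j * x $ j)"
  "((vector [r1, r2, r3, r4, r5] :: ('a::semiring_1)^5^5) *v x) $ 2 = (\<Sum>j\<in>UNIV. r2 $ j * x $ j)"
  "((vector [r1, r2, r3, r4, r5] :: ('a::semiring_1)^5^5) *v x) $ 3 = (\<Sum>j\<in>UNIV. r3 $ j * x $ j)"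
  "((vector [r1, r2, r3, r4, r5] :: ('a::semiring_1)^5^5) *v x) $ 4 = (\<Sum>j\<in>UNIV. r4 $ j * x $ j)"
  "((vector [r1, r2, r3, r4, r5] :: ('a::semiring_1)^5^5) *v x) $ 5 = (\<Sum>j\<in>UNIV. r5 $ j * x $ j)"
  by (simp_all add: matrix_vector_mult_def vector_5)

lemma jacobian_flux0:
  "jacobian flux0 (at (parallel_state \<rho> u h)) =
    vector [vector [1, 0, 0, 0, 0], vector [u, \<rho>, 0, 0, 0], vector [0, 0, \<rho>, 0, 0],
            vector [0, 0, 0, 1, 0], vector [0, 0, 0, 0, 1]]"
  by (rule jacobian_eqI)
     (auto simp: has_derivative_vec_componentwise forall_5 flux0_def Let_def vector_5
        matrix_vector_mult_5 sum_5 parallel_state_def intro!: has_derivative_vec_nth derivative_eq_intros)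

lemma jacobian_flux1:
  assumes "\<rho> > 0"
  shows "jacobian (flux1 a \<gamma> \<beta>) (at (parallel_state \<rho> u h)) =
    vector [vector [u, \<rho>, 0, 0, 0],
            vector [u^2 + a * \<gamma> * \<rho> powr (\<gamma> - 1), 2 * \<rho> * u, 0, - h, 0],
            vector [0, 0, \<rho> * u, 0, - h],
            vector [0, 0, 0, \<beta>, 0],
            vector [0, 0, - h, 0, u]]"
  using assms
  by (intro jacobian_eqI)
     (auto simp: has_derivative_vec_componentwise forall_5 flux1_def Let_def vector_5 pressure_def
        matrix_vector_mult_5 sum_5 parallel_state_def algebra_simps power2_eq_square
        powr_diff
        intro!: has_derivative_vec_nth derivative_eq_intros)

lemma jacobian_flux2:
  assumes "\<rho> > 0"
  shows "jacobian (flux2 a \<gamma> \<beta>) (at (parallel_state \<rho> u h)) =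
    vector [vector [0, 0, \<rho>, 0, 0],
            vector [0, 0, \<rho> * u, 0, - h],
            vector [a * \<gamma> * \<rho> powr (\<gamma> - 1), 0, 0, h, 0],
            vector [0, 0, h, 0, \<beta> - u],
            vector [0, 0, 0, 0, 0]]"
  using assms
  by (intro jacobian_eqI)
     (auto simp: has_derivative_vec_componentwise forall_5 flux2_def Let_def vector_5 pressure_def
        matrix_vector_mult_5 sum_5 parallel_state_def algebra_simps power2_eq_square
        powr_diff
        intro!: has_derivative_vec_nth derivative_eq_intros)

lemma cmat_vector_mult_nth:
  "(cmat M *v x) $ i = (\<Sum>j\<in>UNIV. complex_of_real (M $ i $ j) * x $ j)"
  by (simp add: cmat_def matrix_vector_mult_def)

lemma vec_eq_5_iff:
  "(x :: 'a^5) = y \<longleftrightarrow> x $ 1 = y $ 1 \<and> x $ 2 = y $ 2 \<and> x $ 3 = y $ 3 \<and> x $ 4 = y $ 4 \<and> x $ 5 = y $ 5"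
  by (simp add: vec_eq_iff forall_5)

lemma A0_mult:
  "A0 (parallel_state \<rho> u h) *v x =
    vector [x $ 1, u * x $ 1 + \<rho> * x $ 2, \<rho> * x $ 3, x $ 4, x $ 5]"
  by (simp add: A0_def jacobian_flux0 cmat_vector_mult_nth vec_eq_5_iff vector_5 sum_5)

lemma A1_mult:
  fixes C :: real
  assumes "\<rho> > 0" and "C = a * \<gamma> * \<rho> powr (\<gamma> - 1)"
  shows "A1 a \<gamma> \<beta> (parallel_state \<rho> u h) *v x =
    vector [u * x $ 1 + \<rho> * x $ 2,
            (u\<^sup>2 + C) * x $ 1 + 2 * \<rho> * u * x $ 2 - h * x $ 4,
            \<rho> * u * x $ 3 - h * x $ 5,
            \<beta> * x $ 4,
            u * x $ 5 - h * x $ 3]"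
  using assms(1)
  by (simp add: A1_def jacobian_flux1 assms(2) cmat_vector_mult_nth vec_eq_5_iff vector_5 sum_5)

lemma A2_mult:
  fixes C :: real
  assumes "\<rho> > 0" and "C = a * \<gamma> * \<rho> powr (\<gamma> - 1)"
  shows "A2 a \<gamma> \<beta> (parallel_state \<rho> u h) *v x =
    vector [\<rho> * x $ 3,
            \<rho> * u * x $ 3 - h * x $ 5,
            C * x $ 1 + h * x $ 4,
            h * x $ 3 + (\<beta> - u) * x $ 5,
            0]"
  using assms(1)
  by (simp add: A2_def jacobian_flux2 assms(2) cmat_vector_mult_nth vec_eq_5_iff vector_5 sum_5)

section \<open>From the transformed system to the pencil of the flux Jacobians\<close>

lemma mat_vector_mult: "mat c *v (x :: 'a::comm_semiring_1^'n) = c *s x"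
  by (simp add: matrix_vector_mult_def mat_def vec_eq_iff if_distrib if_distribR cong: if_cong)

lemma matrix_inv_inverse:
  assumes "invertible A"
  shows "A ** matrix_inv A = mat 1" and "matrix_inv A ** A = mat 1"
  using someI_ex[OF assms[unfolded invertible_def]] by (simp_all add: matrix_inv_def)

lemma uminus_matrix_vector_mult: "(- A) *v (x :: 'a::ring_1^'n) = - (A *v x)"
  by (simp add: matrix_vector_mult_def vec_eq_iff sum_negf)

lemma matrix_vector_mult_uminus: "A *v (- x :: 'a::ring_1^'n) = - (A *v x)"
  by (simp add: matrix_vector_mult_def vec_eq_iff sum_negf)

lemma invertible_if_ker_trivial:
  fixes A :: "'a::field^'n^'n"
  assumes "\<And>x. A *v x = 0 \<Longrightarrow> x = 0"
  shows "invertible A"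
  using assms by (simp add: invertible_left_inverse matrix_left_invertible_ker)

text \<open>Row 4 isolates the fourth component. Rows 1, 2 and rows 3, 5 are then two separate
  blocks, with determinants \<open>\<rho> (u\<^sup>2 - C)\<close> and
  \<open>\<rho> u\<^sup>2 - h\<^sup>2\<close>; the hypotheses exclude the sonic and the Alfven
  speed.\<close>

lemma invertible_A1:
  fixes C :: real
  assumes "\<rho> > 0" and "C = a * \<gamma> * \<rho> powr (\<gamma> - 1)"
    and "\<beta> \<noteq> 0" and "C \<noteq> u\<^sup>2" and "\<rho> * u\<^sup>2 \<noteq> h\<^sup>2"
  shows "invertible (A1 a \<gamma> \<beta> (parallel_state \<rho> u h))"
proof (rule invertible_if_ker_trivial)
  fix x assume "A1 a \<gamma> \<beta> (parallel_state \<rho> u h) *v x = 0"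
  then have 1: "u * x $ 1 + \<rho> * x $ 2 = 0"
    and 2: "(u\<^sup>2 + C) * x $ 1 + 2 * \<rho> * u * x $ 2 - h * x $ 4 = 0"
    and 3: "\<rho> * u * x $ 3 - h * x $ 5 = 0"
    and 4: "x $ 4 = 0"
    and 5: "u * x $ 5 - h * x $ 3 = 0"
    using assms by (simp_all add: A1_mult[OF assms(1,2)] vec_eq_5_iff vector_5)
  have "complex_of_real (C - u\<^sup>2) * x $ 1 =
      ((u\<^sup>2 + C) * x $ 1 + 2 * \<rho> * u * x $ 2 - h * x $ 4) - 2 * u * (u * x $ 1 + \<rho> * x $ 2) + h * x $ 4"
    by (simp add: algebra_simps power2_eq_square)
  then have x1: "x $ 1 = 0"
    using 1 2 4 assms(4) by (simp only: mult_zero_right diff_0_right add_0_right mult_eq_0_iff of_real_eq_0_iff) simp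
  have x2: "x $ 2 = 0" using 1 x1 assms(1) by simp
  have "complex_of_real (\<rho> * u\<^sup>2 - h\<^sup>2) * x $ 3 =
      u * (\<rho> * u * x $ 3 - h * x $ 5) + h * (u * x $ 5 - h * x $ 3)"
    by (simp add: algebra_simps power2_eq_square)
  then have x3: "x $ 3 = 0"
    using 3 5 assms(5) by (simp only: mult_zero_right add_0_right mult_eq_0_iff of_real_eq_0_iff) simp
  have "complex_of_real (\<rho> * u\<^sup>2 - h\<^sup>2) * x $ 5 =
      h * (\<rho> * u * x $ 3 - h * x $ 5) + \<rho> * u * (u * x $ 5 - h * x $ 3)"
    by (simp add: algebra_simps power2_eq_square)
  then have x5: "x $ 5 = 0"
    using 3 5 assms(5) by (simp only: mult_zero_right add_0_right mult_eq_0_iff of_real_eq_0_iff) simp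
  show "x = 0" using x1 x2 x3 4 x5 by (simp add: vec_eq_5_iff)
qed

text \<open>Exponents are checked on the pencil \<open>\<mu> A1 + lam A0 + \<i> \<xi> A2\<close>, so
  that the inverse of \<open>A1\<close> never has to be computed.\<close>

lemma symbol_matrix_eigenvector:
  assumes "invertible (A1 a \<gamma> \<beta> W)"
    and "\<mu> *s (A1 a \<gamma> \<beta> W *v w) + (lam *s (A0 W *v w) + (\<i> * complex_of_real \<xi>) *s (A2 a \<gamma> \<beta> W *v w)) = 0"
  shows "symbol_matrix a \<gamma> \<beta> W lam \<xi> *v w = \<mu> *s w"
proof -
  let ?B = "matrix_inv (A1 a \<gamma> \<beta> W)"
  have inv: "?B ** A1 a \<gamma> \<beta> W = mat 1"
    using assms(1) by (simp add: matrix_inv_inverse)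
  have "symbol_matrix a \<gamma> \<beta> W lam \<xi> *v w
      = - (?B *v (lam *s (A0 W *v w) + (\<i> * complex_of_real \<xi>) *s (A2 a \<gamma> \<beta> W *v w)))"
    by (simp only: symbol_matrix_def matrix_vector_mul_assoc[symmetric]
        matrix_vector_mult_add_rdistrib mat_vector_mult uminus_matrix_vector_mult)
  also have "\<dots> = ?B *v (\<mu> *s (A1 a \<gamma> \<beta> W *v w))"
    using assms(2) by (metis add_eq_0_iff2 matrix_vector_mult_uminus)
  also have "\<dots> = \<mu> *s w"
    by (simp add: vector_scalar_commute[symmetric] matrix_vector_mul_assoc inv)
  finally show ?thesis .
qed

section \<open>Decaying solutions of diagonalizable systems\<close>

text \<open>Applying \<open>G\<close> minus \<open>\<mu> j\<close> to the relation removes its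
  \<open>j\<close>-th term and multiplies every other coefficient by a nonzero difference; the
  shorter relation is handled by induction.\<close>

lemma eigenvector_combination_eq_0:
  fixes G :: "'a::field^'n^'n"
  assumes "finite I" and "inj_on \<mu> I"
    and "\<And>i. i \<in> I \<Longrightarrow> G *v w i = \<mu> i *s w i" and "\<And>i. i \<in> I \<Longrightarrow> w i \<noteq> 0"
    and "(\<Sum>i\<in>I. c i *s w i) = 0" and "i \<in> I"
  shows "c i = 0"
  using assms
proof (induction I arbitrary: c i rule: finite_induct)
  case empty
  then show ?case by simp
next
  case (insert j I)
  have "0 = G *v (\<Sum>i\<in>insert j I. c i *s w i) - \<mu> j *s (\<Sum>i\<in>insert j I. c i *s w i)"
    using insert.prems by simp
  also have "G *v (\<Sum>i\<in>insert j I. c i *s w i) = (\<Sum>i\<in>insert j I. (c i * \<mu> i) *s w i)"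
    using insert.prems(2)
    by (simp add: vec.linear_sum[OF matrix_vector_mul_linear_gen] vector_scalar_commute del: sum.insert)
  also have "(\<Sum>i\<in>insert j I. (c i * \<mu> i) *s w i) - \<mu> j *s (\<Sum>i\<in>insert j I. c i *s w i)
      = (\<Sum>i\<in>insert j I. (c i * (\<mu> i - \<mu> j)) *s w i)"
    by (simp add: vec.scale_sum_right sum_subtractf[symmetric] vec.scale_left_diff_distrib
        right_diff_distrib mult.commute del: sum.insert)
  also have "\<dots> = (\<Sum>i\<in>I. (c i * (\<mu> i - \<mu> j)) *s w i)"
    using insert.hyps by simp
  finally have sum0: "(\<Sum>i\<in>I. (c i * (\<mu> i - \<mu> j)) *s w i) = 0" ..
  have "c i * (\<mu> i - \<mu> j) = 0" if "i \<in> I" for i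
    by (rule insert.IH[OF _ _ _ sum0 that]) (use insert.prems in \<open>auto simp: inj_on_def\<close>)
  moreover have "\<mu> i \<noteq> \<mu> j" if "i \<in> I" for i
    using insert.prems(1) insert.hyps(2) that by (auto simp: inj_on_def)
  ultimately have cI: "c i = 0" if "i \<in> I" for i
    using that by auto
  then have "c j *s w j = 0"
    using insert.prems(4) insert.hyps by simp
  then have "c j = 0"
    using insert.prems(3)[of j] by simp
  then show ?case using cI insert.prems(5) by auto
qed

lemma independent_eigenvectors:
  fixes G :: "'a::field^'n^'n"
  assumes "finite I" and "inj_on \<mu> I"
    and "\<And>i. i \<in> I \<Longrightarrow> G *v w i = \<mu> i *s w i" and "\<And>i. i \<in> I \<Longrightarrow> w i \<noteq> 0"
  shows "inj_on w I" and "vec.independent (w ` I)"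
proof -
  show inj: "inj_on w I"
  proof (rule inj_onI)
    fix i j assume ij: "i \<in> I" "j \<in> I" "w i = w j"
    then have "(\<mu> i - \<mu> j) *s w i = 0"
      using assms(3)[of i] assms(3)[of j] by (metis vec.scale_left_diff_distrib right_minus_eq)
    then have "\<mu> i = \<mu> j" using assms(4)[OF ij(1)] by simp
    then show "i = j" using assms(2) ij by (auto simp: inj_on_def)
  qed
  show "vec.independent (w ` I)"
  proof (rule vec.independent_if_scalars_zero)
    show "finite (w ` I)" using assms(1) by simp
    fix f x assume "(\<Sum>x\<in>w ` I. f x *s x) = 0" and "x \<in> w ` I"
    then obtain i where i: "i \<in> I" "x = w i" and "(\<Sum>i\<in>I. f (w i) *s w i) = 0"
      using inj by (auto simp: sum.reindex)
    then show "f x = 0"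
      using eigenvector_combination_eq_0[OF assms, of "\<lambda>i. f (w i)" i] by simp
  qed
qed

text \<open>The integrating factor \<open>exp (- \<mu> * x)\<close> makes the product constant. The
  derivative at 0 is one-sided, as in \<open>decaying_right\<close>.\<close>

lemma scalar_linear_ode_unique:
  fixes f :: "real \<Rightarrow> complex"
  assumes "\<And>x. x \<ge> 0 \<Longrightarrow> (f has_vector_derivative \<mu> * f x) (at x within {0..})" and "x \<ge> 0"
  shows "f x = exp (\<mu> * x) * f 0"
proof -
  have "((\<lambda>x. exp (- \<mu> * x) * f x) has_vector_derivative 0) (at x within {0..})"
    if "x \<in> {0..}" for x :: real
    using that assms(1)[of x]
    by (auto intro!: derivative_eq_intros has_vector_derivative_mult
        has_vector_derivative_real_field simp: algebra_simps)
  then obtain c where c: "\<And>x. x \<in> {0..} \<Longrightarrow> exp (- \<mu> * complex_of_real x) * f x = c"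
    by (rule has_vector_derivative_zero_constant[rotated]) auto
  from c[of x] c[of 0] assms(2) have "exp (- \<mu> * x) * f x = f 0" by simp
  then show ?thesis by (simp add: exp_minus field_simps)
qed

text \<open>For \<open>Re \<mu> \<ge> 0\<close> the modulus of \<open>f\<close> never falls below
  its initial value. Neutral exponents are thereby excluded from the decaying space along with the
  growing ones.\<close>

lemma decaying_scalar_linear_ode_eq_0:
  fixes f :: "real \<Rightarrow> complex"
  assumes "\<And>x. x \<ge> 0 \<Longrightarrow> (f has_vector_derivative \<mu> * f x) (at x within {0..})"
    and "(f \<longlongrightarrow> 0) at_top" and "Re \<mu> \<ge> 0"
  shows "f 0 = 0"
proof -
  have le: "norm (f 0) \<le> norm (f x)" if "x \<ge> 0" for x
  proof -
    have "norm (f x) = exp (Re \<mu> * x) * norm (f 0)"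
      using scalar_linear_ode_unique[OF assms(1) that] by (simp add: norm_mult)
    moreover have "1 \<le> exp (Re \<mu> * x)" using assms(3) that by simp
    ultimately show ?thesis
      using mult_right_mono[of 1 "exp (Re \<mu> * x)" "norm (f 0)"] by simp
  qed
  have "\<forall>\<^sub>F x in at_top. norm (f 0) \<le> norm (f x)"
    by (rule eventually_mono[OF eventually_ge_at_top[of "0::real"]]) (rule le)
  moreover have "((\<lambda>x. norm (f x)) \<longlongrightarrow> 0) at_top"
    using assms(2) by (rule tendsto_norm_zero)
  ultimately have "norm (f 0) \<le> 0"
    by (intro tendsto_lowerbound[of _ _ at_top]) auto
  then show ?thesis by simp
qed

lemma bounded_linear_matrix_vector_nth:
  "bounded_linear (\<lambda>z :: complex^'n. (A *v z) $ i)"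
  by (rule linear_conv_bounded_linear[THEN iffD1], rule linearI)
     (simp_all add: matrix_vector_mult_def scaleR_sum_right distrib_left sum.distrib)

lemma bounded_linear_scalar_mult_vector: "bounded_linear (\<lambda>c. c *s (w :: complex^'n))"
  by (rule linear_conv_bounded_linear[THEN iffD1], rule linearI)
     (simp_all add: vec_eq_iff algebra_simps)

lemma eigenvector_in_decaying_right:
  assumes "G *v w = \<mu> *s w" and "Re \<mu> < 0"
  shows "w \<in> decaying_right G"
proof -
  let ?v = "\<lambda>x::real. exp (\<mu> * x) *s w"
  have "?v 0 \<in> decaying_right G"
  proof (rule decaying_rightI[where v = ?v])
    fix x :: real assume "x \<ge> 0"
    have "((\<lambda>x::real. exp (\<mu> * x)) has_vector_derivative exp (\<mu> * x) * \<mu>) (at x within {0..})"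
      by (rule has_vector_derivative_real_field) (auto intro!: derivative_eq_intros)
    then have "(?v has_vector_derivative (exp (\<mu> * x) * \<mu>) *s w) (at x within {0..})"
      by (rule bounded_linear.has_vector_derivative[OF bounded_linear_scalar_mult_vector])
    then show "(?v has_vector_derivative G *v ?v x) (at x within {0..})"
      by (simp add: vector_scalar_commute assms(1))
  next
    have "((\<lambda>x::real. exp (Re \<mu> * x)) \<longlongrightarrow> 0) at_top"
      using assms(2)
      by (intro filterlim_compose[OF exp_at_bot] filterlim_tendsto_neg_mult_at_bot[OF tendsto_const])
         (auto simp: filterlim_ident)
    then have "((\<lambda>x::real. exp (\<mu> * x)) \<longlongrightarrow> 0) at_top"
      by (intro tendsto_norm_zero_cancel[where f="\<lambda>x::real. exp (\<mu> * x)"]) simp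
    then show "(?v \<longlongrightarrow> 0) at_top"
      by (rule bounded_linear.tendsto_zero[OF bounded_linear_scalar_mult_vector])
  qed
  then show ?thesis by simp
qed

text \<open>Five distinct exponents make the modes a basis in which the system splits into scalar
  equations; decay then kills every coordinate with \<open>Re (\<mu> i) \<ge> 0\<close>.\<close>

lemma decaying_right_eq_span:
  fixes \<mu> :: "5 \<Rightarrow> complex"
  assumes "inj \<mu>" and eig: "\<And>i. G *v w i = \<mu> i *s w i" and nz: "\<And>i. w i \<noteq> 0"
  shows "decaying_right G = vec.span (w ` {i. Re (\<mu> i) < 0})"
proof (rule subset_antisym)
  show "vec.span (w ` {i. Re (\<mu> i) < 0}) \<subseteq> decaying_right G"
    by (rule vec.span_minimal[OF _ subspace_decaying_right])
       (auto intro: eigenvector_in_decaying_right[OF eig])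
  \<comment> \<open>The modes are the columns of \<open>W\<close>, so \<open>matrix_inv W\<close>
    reads off coordinates with respect to them.\<close>
  define W where "W = (\<chi> r i. w i $ r)"
  have W: "W *v c = (\<Sum>i\<in>UNIV. c $ i *s w i)" for c
    by (simp add: W_def matrix_vector_mult_def vec_eq_iff mult.commute)
  have "invertible W"
  proof (rule invertible_if_ker_trivial)
    fix c assume "W *v c = 0"
    then have "(\<Sum>i\<in>UNIV. c $ i *s w i) = 0" by (simp only: W)
    then have "c $ i = 0" for i
      by (rule eigenvector_combination_eq_0[OF finite assms(1) eig nz]) (rule UNIV_I)
    then show "c = 0" by (simp add: vec_eq_iff)
  qed
  note inv = matrix_inv_inverse[OF this]
  let ?y = "\<lambda>z. matrix_inv W *v z"
  have expand: "z = (\<Sum>i\<in>UNIV. ?y z $ i *s w i)" for z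
    unfolding W[symmetric] by (simp add: matrix_vector_mul_assoc inv)
  have coord: "?y (G *v z) $ i = \<mu> i * ?y z $ i" for z i
  proof -
    have "G *v z = (\<Sum>i\<in>UNIV. (\<mu> i * ?y z $ i) *s w i)"
      by (subst expand[of z])
         (simp add: vec.linear_sum[OF matrix_vector_mul_linear_gen] vector_scalar_commute eig mult.commute)
    also have "\<dots> = W *v (\<chi> i. \<mu> i * ?y z $ i)" by (simp add: W)
    finally show ?thesis by (simp add: matrix_vector_mul_assoc inv)
  qed
  show "decaying_right G \<subseteq> vec.span (w ` {i. Re (\<mu> i) < 0})"
  proof
    fix z assume "z \<in> decaying_right G"
    then obtain v where v: "z = v 0"
      "\<And>x. x \<ge> 0 \<Longrightarrow> (v has_vector_derivative (G *v v x)) (at x within {0..})" "(v \<longlongrightarrow> 0) at_top"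
      unfolding decaying_right_def by blast
    have "?y z $ i = 0" if "\<not> Re (\<mu> i) < 0" for i
      unfolding v(1)
    proof (rule decaying_scalar_linear_ode_eq_0[where f = "\<lambda>x. ?y (v x) $ i"])
      show "((\<lambda>x. ?y (v x) $ i) has_vector_derivative \<mu> i * ?y (v x) $ i) (at x within {0..})"
        if "x \<ge> 0" for x
        using bounded_linear.has_vector_derivative[OF bounded_linear_matrix_vector_nth v(2)[OF that],
            of "matrix_inv W" i]
        by (simp only: coord)
      show "((\<lambda>x. ?y (v x) $ i) \<longlongrightarrow> 0) at_top"
        by (rule bounded_linear.tendsto_zero[OF bounded_linear_matrix_vector_nth v(3)])
      show "Re (\<mu> i) \<ge> 0" using that by simp
    qed
    then have "?y z $ i *s w i \<in> vec.span (w ` {i. Re (\<mu> i) < 0})" for i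
      by (cases "Re (\<mu> i) < 0") (auto intro: vec.span_scale vec.span_base vec.span_zero)
    then have "(\<Sum>i\<in>UNIV. ?y z $ i *s w i) \<in> vec.span (w ` {i. Re (\<mu> i) < 0})"
      by (intro vec.span_sum)
    then show "z \<in> vec.span (w ` {i. Re (\<mu> i) < 0})"
      by (simp only: expand[symmetric])
  qed
qed

lemma dim_decaying_right:
  fixes \<mu> :: "5 \<Rightarrow> complex"
  assumes "inj \<mu>" and "\<And>i. G *v w i = \<mu> i *s w i" and "\<And>i. w i \<noteq> 0"
  shows "vec.dim (decaying_right G) = card {i. Re (\<mu> i) < 0}"
proof -
  let ?I = "{i. Re (\<mu> i) < 0}"
  have "inj_on w ?I" "vec.independent (w ` ?I)"
    by (rule independent_eigenvectors[of ?I \<mu> G w]; use assms in \<open>auto intro: inj_on_subset\<close>)+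
  then show ?thesis
    by (simp add: decaying_right_eq_span[OF assms] vec.dim_eq_card_independent card_image)
qed

text \<open>Reflecting the line about 0 changes the sign of \<open>G\<close>, which spares a
  separate treatment of the left half-line.\<close>

lemma decaying_left_eq: "decaying_left G = decaying_right (- G)"
proof (intro subset_antisym subsetI)
  fix z assume "z \<in> decaying_left G"
  then obtain v where v: "z = v 0"
    "\<And>x. x \<le> 0 \<Longrightarrow> (v has_vector_derivative (G *v v x)) (at x within {..0})" "(v \<longlongrightarrow> 0) at_bot"
    unfolding decaying_left_def by blast
  have "v (- 0) \<in> decaying_right (- G)"
  proof (rule decaying_rightI[where v = "\<lambda>x. v (- x)"])
    fix x :: real assume "x \<ge> 0"
    have "((v \<circ> uminus) has_vector_derivative (-1) *\<^sub>R (G *v v (- x))) (at x within {0..})"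
      using \<open>x \<ge> 0\<close> v(2)[of "- x"]
      by (intro vector_diff_chain_within) (auto intro!: derivative_eq_intros)
    then show "((\<lambda>x. v (- x)) has_vector_derivative - G *v v (- x)) (at x within {0..})"
      by (simp add: o_def uminus_matrix_vector_mult)
  next
    show "((\<lambda>x. v (- x)) \<longlongrightarrow> 0) at_top"
      using v(3) by (simp add: filterlim_at_bot_mirror)
  qed
  then show "z \<in> decaying_right (- G)" by (simp add: v(1))
next
  fix z assume "z \<in> decaying_right (- G)"
  then obtain v where v: "z = v 0"
    "\<And>x. x \<ge> 0 \<Longrightarrow> (v has_vector_derivative (- G *v v x)) (at x within {0..})" "(v \<longlongrightarrow> 0) at_top"
    unfolding decaying_right_def by blast
  have "v (- 0) \<in> decaying_left G"
  proof (rule decaying_leftI[where v = "\<lambda>x. v (- x)"])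
    fix x :: real assume "x \<le> 0"
    have "((v \<circ> uminus) has_vector_derivative (-1) *\<^sub>R (- G *v v (- x))) (at x within {..0})"
      using \<open>x \<le> 0\<close> v(2)[of "- x"]
      by (intro vector_diff_chain_within) (auto intro!: derivative_eq_intros)
    then show "((\<lambda>x. v (- x)) has_vector_derivative G *v v (- x)) (at x within {..0})"
      by (simp add: o_def uminus_matrix_vector_mult)
  next
    show "((\<lambda>x. v (- x)) \<longlongrightarrow> 0) at_bot"
      using v(3) by (simp add: filterlim_at_bot_mirror)
  qed
  then show "z \<in> decaying_left G" by (simp add: v(1))
qed

lemma eigenvector_in_decaying_left:
  assumes "G *v w = \<mu> *s w" and "Re \<mu> > 0"
  shows "w \<in> decaying_left G"
  unfolding decaying_left_eq
  by (rule eigenvector_in_decaying_right[where \<mu> = "- \<mu>"])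
     (use assms in \<open>simp_all add: uminus_matrix_vector_mult\<close>)

lemma dim_decaying_left:
  fixes \<mu> :: "5 \<Rightarrow> complex"
  assumes "inj \<mu>" and "\<And>i. G *v w i = \<mu> i *s w i" and "\<And>i. w i \<noteq> 0"
  shows "vec.dim (decaying_left G) = card {i. Re (\<mu> i) > 0}"
proof -
  have "vec.dim (decaying_left G) = card {i. Re (- \<mu> i) < 0}"
    unfolding decaying_left_eq
    by (rule dim_decaying_right[where w = w])
       (use assms in \<open>auto simp: uminus_matrix_vector_mult inj_def\<close>)
  then show ?thesis by simp
qed

section \<open>Exponents and modes\<close>

definition dispersion :: "real \<Rightarrow> real \<Rightarrow> real \<Rightarrow> real \<Rightarrow> real \<Rightarrow> real \<Rightarrow> real" where
  "dispersion \<rho> u C h lam \<mu> =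
     (\<rho> * (lam + \<mu> * u)\<^sup>2 + h\<^sup>2 * (1 - \<mu>\<^sup>2)) * ((lam + \<mu> * u)\<^sup>2 - C * \<mu>\<^sup>2) + \<rho> * C * (lam + \<mu> * u)\<^sup>2"

text \<open>The amplitude of the solution \<open>exp (\<mu> x) w\<close> with \<open>\<mu> h\<^sub>1 + \<i> h\<^sub>2 = 0\<close>, normalised so that no division by \<open>s\<close>
  occurs.\<close>

definition mode :: "real \<Rightarrow> real \<Rightarrow> real \<Rightarrow> real \<Rightarrow> real \<Rightarrow> real \<Rightarrow> complex^5" where
  "mode \<rho> u C h lam \<mu> =
     (let s = lam + \<mu> * u; P = s\<^sup>2 - C * \<mu>\<^sup>2 in
      vector [of_real (\<rho> * s\<^sup>2), of_real (- (\<mu> * C * s)), \<i> * of_real (s * P),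
              of_real (h * P), \<i> * of_real (\<mu> * h * P)])"

text \<open>With this amplitude four rows vanish identically in \<mu>. The transverse momentum row
  equals \<open>\<i>\<close> times the dispersion polynomial and is the only one that needs
  \<open>\<mu>\<close> to be a root.\<close>

lemma mode_symbol_eq_0:
  fixes C :: real
  assumes "\<rho> > 0" and "C = a * \<gamma> * \<rho> powr (\<gamma> - 1)"
    and "dispersion \<rho> u C h lam \<mu> = 0"
  shows "complex_of_real \<mu> *s (A1 a \<gamma> \<beta> (parallel_state \<rho> u h) *v mode \<rho> u C h lam \<mu>) +
     (complex_of_real lam *s (A0 (parallel_state \<rho> u h) *v mode \<rho> u C h lam \<mu>) +
      (\<i> * complex_of_real 1) *s (A2 a \<gamma> \<beta> (parallel_state \<rho> u h) *v mode \<rho> u C h lam \<mu>)) = 0"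
proof -
  define s where "s = lam + \<mu> * u"
  have lam: "lam = s - \<mu> * u" by (simp add: s_def)
  have disp: "(\<rho> * s\<^sup>2 + h\<^sup>2 * (1 - \<mu>\<^sup>2)) * (s\<^sup>2 - C * \<mu>\<^sup>2) + \<rho> * C * s\<^sup>2 = 0"
    using assms(3) by (simp add: dispersion_def s_def)
  show ?thesis
    unfolding A0_mult A1_mult[OF assms(1,2)] A2_mult[OF assms(1,2)] mode_def Let_def
      s_def[symmetric]
    unfolding lam vec_eq_5_iff
    by (simp add: vector_5 complex_eq_iff, intro conjI)
      (use disp in \<open>simp_all add: algebra_simps power2_eq_square\<close>)
qed

lemma mode_nonzero:
  assumes "\<mu> \<noteq> 0" and "C > 0" and "h \<noteq> 0"
  shows "mode \<rho> u C h lam \<mu> \<noteq> 0"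
proof
  assume "mode \<rho> u C h lam \<mu> = 0"
  then have "lam + \<mu> * u = 0" and "(lam + \<mu> * u)\<^sup>2 = C * \<mu>\<^sup>2"
    using assms by (auto simp: mode_def Let_def vec_eq_5_iff vector_5 complex_eq_iff)
  then show False using assms by simp
qed

text \<open>Rows 4 and 5 are both multiples of \<open>P\<close>, hence give one and the same
  condition on a combination of modes. Each entry is real or purely imaginary, uniformly over the
  modes, which permits real coefficients.\<close>

lemma A1_mult_mode:
  fixes C :: real
  assumes "\<rho> > 0" and "C = a * \<gamma> * \<rho> powr (\<gamma> - 1)"
  shows "A1 a \<gamma> \<beta> (parallel_state \<rho> u h) *v mode \<rho> u C h lam \<mu> =
    (let s = lam + \<mu> * u; P = s\<^sup>2 - C * \<mu>\<^sup>2 in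
     vector [of_real (\<rho> * s * (u * s - C * \<mu>)),
             of_real (\<rho> * s * ((u\<^sup>2 + C) * s - 2 * u * \<mu> * C) - h\<^sup>2 * P),
             \<i> * of_real (P * (\<rho> * u * s - h\<^sup>2 * \<mu>)),
             of_real (\<beta> * h * P),
             - \<i> * of_real (h * lam * P)])"
proof -
  define s where "s = lam + \<mu> * u"
  have lam: "lam = s - \<mu> * u" by (simp add: s_def)
  show ?thesis
    unfolding A1_mult[OF assms] mode_def Let_def s_def[symmetric] unfolding lam vec_eq_5_iff
    by (simp add: vector_5 complex_eq_iff) (simp add: algebra_simps power2_eq_square)
qed

text \<open>The induction equations make rows 4 and 5 of the symbol proportional at
  \<open>\<mu> = - lam / \<beta>\<close>; this is the mode transporting the divergence of the magnetic field.\<close>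

lemma divergence_mode:
  fixes C :: real
  assumes "\<rho> > 0" and "C = a * \<gamma> * \<rho> powr (\<gamma> - 1)" and "\<beta> \<noteq> 0"
  obtains w where "w \<noteq> 0"
    and "complex_of_real (- lam / \<beta>) *s (A1 a \<gamma> \<beta> (parallel_state \<rho> u h) *v w) +
     (complex_of_real lam *s (A0 (parallel_state \<rho> u h) *v w) +
      (\<i> * complex_of_real 1) *s (A2 a \<gamma> \<beta> (parallel_state \<rho> u h) *v w)) = 0"
proof -
  let ?W = "parallel_state \<rho> u h" and ?\<mu> = "complex_of_real (- lam / \<beta>)"
  define S where "S = mat ?\<mu> ** A1 a \<gamma> \<beta> ?W +
    (mat (complex_of_real lam) ** A0 ?W + mat (\<i> * complex_of_real 1) ** A2 a \<gamma> \<beta> ?W)"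
  have S: "S *v w = ?\<mu> *s (A1 a \<gamma> \<beta> ?W *v w) + (complex_of_real lam *s (A0 ?W *v w) +
      (\<i> * complex_of_real 1) *s (A2 a \<gamma> \<beta> ?W *v w))" for w
    by (simp only: S_def matrix_vector_mult_add_rdistrib matrix_vector_mul_assoc[symmetric] mat_vector_mult)
  have rows: "complex_of_real lam * (S *v w) $ 4 = \<i> * \<beta> * (S *v w) $ 5" for w
    using assms(3)
    unfolding S A0_mult A1_mult[OF assms(1,2)] A2_mult[OF assms(1,2)]
    by (simp add: vector_5 field_simps)
  have "\<not> invertible S"
  proof
    assume "invertible S"
    then have inv: "S *v (matrix_inv S *v axis 5 1) = axis 5 1"
      by (simp add: matrix_vector_mul_assoc matrix_inv_inverse)
    show False
      using rows[of "matrix_inv S *v axis 5 1"] assms(3) unfolding inv by (simp add: axis_def)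
  qed
  then obtain w where "S *v w = 0" "w \<noteq> 0"
    using invertible_if_ker_trivial by blast
  then show thesis using that S by simp
qed

text \<open>Non-resonance separates the divergence exponent from the roots of the quartic. All five
  exponents are then distinct, so the symbol is diagonalizable and no generalized modes
  arise.\<close>

lemma eigenbasis:
  fixes C :: real
  assumes "\<rho> > 0" and "C = a * \<gamma> * \<rho> powr (\<gamma> - 1)"
    and "\<beta> > 0" and "C > 0" and "C \<noteq> u\<^sup>2" and "\<rho> * u\<^sup>2 < h\<^sup>2" and "lam > 0"
    and "m1 < m2" and "m2 < m3" and "m3 < m4"
    and roots: "\<And>m. m \<in> {m1, m2, m3, m4} \<Longrightarrow> m \<noteq> 0 \<and> dispersion \<rho> u C h lam m = 0"
    and nonresonant: "dispersion \<rho> u C h lam (- lam / \<beta>) \<noteq> 0"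
  obtains w :: "5 \<Rightarrow> complex^5" where
    "\<And>i. symbol_matrix a \<gamma> \<beta> (parallel_state \<rho> u h) lam 1 *v w i =
       complex_of_real (vector [m1, m2, m3, m4, - lam / \<beta>] $ i) *s w i"
    and "\<And>i. w i \<noteq> 0"
    and "inj (\<lambda>i::5. complex_of_real (vector [m1, m2, m3, m4, - lam / \<beta>] $ i))"
proof -
  have h: "h \<noteq> 0" using assms(1,6) by (auto simp: power2_eq_square mult_less_0_iff)
  have "invertible (A1 a \<gamma> \<beta> (parallel_state \<rho> u h))"
    using assms(3,5,6) by (intro invertible_A1[OF assms(1,2)]) auto
  note eig = symbol_matrix_eigenvector[OF this]
  obtain w0 where w0: "w0 \<noteq> 0"
    "symbol_matrix a \<gamma> \<beta> (parallel_state \<rho> u h) lam 1 *v w0 = complex_of_real (- lam / \<beta>) *s w0"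
    using divergence_mode[OF assms(1,2), of \<beta> lam u h] assms(3) eig by (metis less_irrefl)
  define w where "w = (\<lambda>i::5. if i = 5 then w0
    else mode \<rho> u C h lam (vector [m1, m2, m3, m4, - lam / \<beta>] $ i))"
  have mode: "symbol_matrix a \<gamma> \<beta> (parallel_state \<rho> u h) lam 1 *v mode \<rho> u C h lam m =
      complex_of_real m *s mode \<rho> u C h lam m" "mode \<rho> u C h lam m \<noteq> 0"
    if "m \<in> {m1, m2, m3, m4}" for m
    using roots[OF that] eig[OF mode_symbol_eq_0[OF assms(1,2)]] mode_nonzero assms(4) h by auto
  have neq: "m \<noteq> - lam / \<beta>" if "m \<in> {m1, m2, m3, m4}" for m
    using roots[OF that] nonresonant by auto
  show thesis
  proof (rule that[of w])
    show "symbol_matrix a \<gamma> \<beta> (parallel_state \<rho> u h) lam 1 *v w i =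
       complex_of_real (vector [m1, m2, m3, m4, - lam / \<beta>] $ i) *s w i" for i
      using exhaust_5[of i] w0(2) by (elim disjE) (simp_all add: w_def vector_5 mode)
    show "w i \<noteq> 0" for i
      using exhaust_5[of i] w0(1) by (elim disjE) (simp_all add: w_def vector_5 mode)
    have "\<forall>i j. vector [m1, m2, m3, m4, - lam / \<beta>] $ i = vector [m1, m2, m3, m4, - lam / \<beta>] $ j
        \<longrightarrow> i = (j::5)"
      using assms(8-10) neq[of m1] neq[of m2] neq[of m3] neq[of m4]
      unfolding forall_5 vector_5 by auto
    then show "inj (\<lambda>i::5. complex_of_real (vector [m1, m2, m3, m4, - lam / \<beta>] $ i))"
      by (auto simp: inj_def)
  qed
qed

section \<open>Location of the exponents and dimensions of the decaying spaces\<close>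

lemma ex_root_between:
  fixes f :: "real \<Rightarrow> real"
  assumes "a < b" and "continuous_on {a..b} f" and "f a * f b < 0"
  obtains x where "a < x" and "x < b" and "f x = 0"
proof -
  have "\<exists>x. a \<le> x \<and> x \<le> b \<and> f x = 0"
  proof (cases "f a < 0")
    case True
    then show ?thesis using IVT'[of f a 0 b] assms by (auto simp: mult_less_0_iff)
  next
    case False
    then show ?thesis using IVT2'[of f b 0 a] assms by (auto simp: mult_less_0_iff)
  qed
  then obtain x where "a \<le> x" "x \<le> b" "f x = 0" by blast
  then show thesis using that[of x] assms(3) by (cases "x = a \<or> x = b") auto
qed

lemma continuous_on_dispersion: "continuous_on S (dispersion \<rho> u C h lam)"
  unfolding dispersion_def by (intro continuous_intros)

lemma dispersion_0: "dispersion \<rho> u C h lam 0 = (\<rho> * lam\<^sup>2 + h\<^sup>2) * lam\<^sup>2 + \<rho> * C * lam\<^sup>2"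
  by (simp add: dispersion_def)

text \<open>The field term drops out when \<open>\<mu>\<^sup>2 = 1\<close>, and a fourth power
  remains; the sign at \<plusminus>1 is therefore known for every \<open>h\<close>.\<close>

lemma dispersion_at_unit:
  assumes "\<mu>\<^sup>2 = 1"
  shows "dispersion \<rho> u C h lam \<mu> = \<rho> * (lam + \<mu> * u) ^ 4"
  unfolding dispersion_def assms by (simp add: power4_eq_xxxx power2_eq_square algebra_simps)

text \<open>At the exponent of transport along the flow, \<open>s = lam + \<mu> u\<close> vanishes,
  and only the product of the field term with \<open>- C \<mu>\<^sup>2\<close> survives.\<close>

lemma dispersion_neg_advected:
  assumes "0 < lam" and "lam < u" and "C > 0" and "h \<noteq> 0"
  shows "dispersion \<rho> u C h lam (- lam / u) < 0"
proof -
  have "(lam / u)\<^sup>2 < 1" using assms by (simp add: power_less_one_iff)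
  moreover have "dispersion \<rho> u C h lam (- lam / u) = - (h\<^sup>2 * (1 - (lam / u)\<^sup>2) * (C * (lam / u)\<^sup>2))"
    using assms by (simp add: dispersion_def)
  ultimately show ?thesis using assms by simp
qed

text \<open>The signs +, -, +, -, + at \<open>-1\<close>, \<open>- lam / u\<close>,
  \<open>0\<close>, \<open>1 / 2\<close>, \<open>1\<close> yield two negative and two positive
  roots; \<open>- lam / \<beta>\<close> is the third negative exponent. The point
  \<open>1 / 2\<close> is merely a convenient one inside (0, 1), where subsonic flow makes the
  quartic negative once \<open>h\<close> is large.\<close>

lemma dim_decaying_subsonic:
  fixes C :: real
  assumes "\<rho> > 0" and "C = a * \<gamma> * \<rho> powr (\<gamma> - 1)"
    and "\<beta> > 0" and "C > u\<^sup>2" and "\<rho> * u\<^sup>2 < h\<^sup>2" and "0 < lam" and "lam < u"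
    and "dispersion \<rho> u C h lam (1 / 2) < 0"
    and "dispersion \<rho> u C h lam (- lam / \<beta>) \<noteq> 0"
  shows "vec.dim (decaying_right (symbol_matrix a \<gamma> \<beta> (parallel_state \<rho> u h) lam 1)) = 3"
proof -
  let ?Q = "dispersion \<rho> u C h lam"
  have u: "u > 0" using assms by simp
  have C: "C > 0" using assms(4) by (smt (verit) zero_le_power2)
  have h: "h \<noteq> 0" using assms(1,5) by (auto simp: power2_eq_square mult_less_0_iff)
  have neg: "?Q (- lam / u) < 0" using dispersion_neg_advected assms C h by blast
  have pos: "?Q 0 > 0" "?Q 1 > 0" "?Q (-1) > 0"
    using assms C u h by (auto simp: dispersion_0 dispersion_at_unit intro!: add_pos_pos mult_pos_pos add_nonneg_pos)
  have lamu: "- 1 < - lam / u" "- lam / u < 0" using assms u by (auto simp: field_simps)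
  obtain m1 where m1: "m1 < - lam / u" "?Q m1 = 0"
    using ex_root_between[OF lamu(1) continuous_on_dispersion mult_pos_neg[OF pos(3) neg]] by blast
  obtain m2 where m2: "- lam / u < m2" "m2 < 0" "?Q m2 = 0"
    using ex_root_between[OF lamu(2) continuous_on_dispersion mult_neg_pos[OF neg pos(1)]] by blast
  obtain m3 where m3: "0 < m3" "m3 < 1 / 2" "?Q m3 = 0"
    using ex_root_between[OF _ continuous_on_dispersion mult_pos_neg[OF pos(1) assms(8)]] by auto
  obtain m4 where m4: "1 / 2 < m4" "?Q m4 = 0"
    using ex_root_between[OF _ continuous_on_dispersion mult_neg_pos[OF assms(8) pos(2)]] by auto
  note m = m1 m2 m3 m4
  have ord: "m1 < m2" "m2 < m3" "m3 < m4" using m by linarith+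
  have roots: "m \<noteq> 0 \<and> ?Q m = 0" if "m \<in> {m1, m2, m3, m4}" for m
    using that m lamu by auto
  obtain w :: "5 \<Rightarrow> complex^5" where w:
    "\<And>i. symbol_matrix a \<gamma> \<beta> (parallel_state \<rho> u h) lam 1 *v w i =
       complex_of_real (vector [m1, m2, m3, m4, - lam / \<beta>] $ i) *s w i"
    "\<And>i. w i \<noteq> 0"
    "inj (\<lambda>i::5. complex_of_real (vector [m1, m2, m3, m4, - lam / \<beta>] $ i))"
    using eigenbasis[OF assms(1-3) C _ assms(5,6) ord roots assms(9)] assms(4) by blast
  have "- lam / \<beta> < 0" using assms by simp
  then have "{i::5. Re (complex_of_real (vector [m1, m2, m3, m4, - lam / \<beta>] $ i)) < 0} = {1, 2, 5}"
    unfolding set_eq_iff forall_5 using m lamu by (simp add: vector_5)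
  then show ?thesis
    unfolding dim_decaying_right[OF w(3,1,2)] by simp
qed

text \<open>The leading coefficient \<open>(\<rho> u\<^sup>2 - h\<^sup>2) (u\<^sup>2 - C)\<close> is
  negative for supersonic flow in a slow field, while the values at \<plusminus>1 are positive. So
  one root lies on either side of [-1, 1]; the other two are negative because of the signs +, -, +
  at \<open>-1\<close>, \<open>- lam / u\<close>, \<open>0\<close>.\<close>

lemma dim_decaying_supersonic:
  fixes C :: real
  assumes "\<rho> > 0" and "C = a * \<gamma> * \<rho> powr (\<gamma> - 1)"
    and "\<beta> > 0" and "0 < C" and "C < u\<^sup>2" and "\<rho> * u\<^sup>2 < h\<^sup>2" and "0 < lam" and "lam < u"
    and "dispersion \<rho> u C h lam (- lam / \<beta>) \<noteq> 0"
  shows "vec.dim (decaying_left (symbol_matrix a \<gamma> \<beta> (parallel_state \<rho> u h) lam 1)) = 1"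
proof -
  let ?Q = "dispersion \<rho> u C h lam"
  have u: "u > 0" using assms by simp
  have h: "h \<noteq> 0" using assms(1,6) by (auto simp: power2_eq_square mult_less_0_iff)
  have neg: "?Q (- lam / u) < 0" using dispersion_neg_advected assms h by blast
  have pos: "?Q 0 > 0" "?Q 1 > 0" "?Q (-1) > 0"
    using assms u h by (auto simp: dispersion_0 dispersion_at_unit intro!: add_pos_pos mult_pos_pos add_nonneg_pos)
  \<comment> \<open>the roots outside \<open>[-1, 1]\<close> are found at \<open>\<mu> = 1 / t\<close>\<close>
  define q where "q t = (\<rho> * (lam * t + u)\<^sup>2 + h\<^sup>2 * (t\<^sup>2 - 1)) * ((lam * t + u)\<^sup>2 - C) + \<rho> * C * (lam * t + u)\<^sup>2 * t\<^sup>2" for t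
  have q: "q t = t ^ 4 * ?Q (1 / t)" if "t \<noteq> 0" for t
  proof -
    have "lam * t + u = t * (lam + 1 / t * u)" "t\<^sup>2 - 1 = t\<^sup>2 * (1 - (1 / t)\<^sup>2)" "C = t\<^sup>2 * (C * (1 / t)\<^sup>2)"
      using that by (simp_all add: field_simps)
    then show ?thesis
      unfolding q_def dispersion_def by (simp only: power_mult_distrib) algebra
  qed
  have cont: "continuous_on S q" for S
    unfolding q_def by (intro continuous_intros)
  have q0: "q 0 < 0"
    using assms by (simp add: q_def mult_less_0_iff)
  have q1: "q 1 > 0" "q (-1) > 0" using q[of 1] q[of "-1"] pos by simp_all
  obtain t1 where t1: "-1 < t1" "t1 < 0" "q t1 = 0"
    using ex_root_between[OF _ cont, of "-1" 0] q0 q1 by (auto simp: mult_pos_neg)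
  obtain t4 where t4: "0 < t4" "t4 < 1" "q t4 = 0"
    using ex_root_between[OF _ cont, of 0 1] q0 q1 by (auto simp: mult_neg_pos)
  have lamu: "- 1 < - lam / u" "- lam / u < 0" using assms u by (auto simp: field_simps)
  obtain m2 where m2: "- 1 < m2" "m2 < - lam / u" "?Q m2 = 0"
    using ex_root_between[OF lamu(1) continuous_on_dispersion mult_pos_neg[OF pos(3) neg]] by blast
  obtain m3 where m3: "- lam / u < m3" "m3 < 0" "?Q m3 = 0"
    using ex_root_between[OF lamu(2) continuous_on_dispersion mult_neg_pos[OF neg pos(1)]] by blast
  define m1 where "m1 = 1 / t1"
  define m4 where "m4 = 1 / t4"
  have m1: "m1 < - 1" "?Q m1 = 0" and m4: "0 < m4" "?Q m4 = 0"
    using t1 t4 q[of t1] q[of t4] by (auto simp: m1_def m4_def field_simps)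
  have ord: "m1 < m2" "m2 < m3" "m3 < m4" using m1 m2 m3 m4 by linarith+
  have roots: "m \<noteq> 0 \<and> ?Q m = 0" if "m \<in> {m1, m2, m3, m4}" for m
    using that m1 m2 m3 m4 lamu by auto
  obtain w :: "5 \<Rightarrow> complex^5" where w:
    "\<And>i. symbol_matrix a \<gamma> \<beta> (parallel_state \<rho> u h) lam 1 *v w i =
       complex_of_real (vector [m1, m2, m3, m4, - lam / \<beta>] $ i) *s w i"
    "\<And>i. w i \<noteq> 0"
    "inj (\<lambda>i::5. complex_of_real (vector [m1, m2, m3, m4, - lam / \<beta>] $ i))"
    using eigenbasis[OF assms(1-4) _ assms(6,7) ord roots assms(9)] assms(5) by blast
  have "- lam / \<beta> < 0" using assms by simp
  then have "{i::5. Re (complex_of_real (vector [m1, m2, m3, m4, - lam / \<beta>] $ i)) > 0} = {4}"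
    unfolding set_eq_iff forall_5 using m1 m2 m3 m4 lamu by (simp add: vector_5)
  then show ?thesis
    unfolding dim_decaying_left[OF w(3,1,2)] by simp
qed

section \<open>Vanishing of the Lopatinsky determinant\<close>

lemma is_basis_length:
  assumes "is_basis E S"
  shows "length E = vec.dim S"
proof -
  have "vec.dim S = card (set E)"
    using assms unfolding is_basis_def by (metis vec.dim_span_eq_card_independent)
  then show ?thesis using assms by (simp add: is_basis_def distinct_card)
qed

lemma det_columns_dependent:
  fixes r1 r2 r3 r4 r5 c :: "'a::field^5"
  assumes "c $ 1 *s r1 + c $ 2 *s r2 + c $ 3 *s r3 + c $ 4 *s r4 + c $ 5 *s r5 = 0" and "c \<noteq> 0"
  shows "det (transpose (vector [r1, r2, r3, r4, r5] :: 'a^5^5)) = 0"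
proof (rule ccontr)
  let ?M = "transpose (vector [r1, r2, r3, r4, r5] :: 'a^5^5)"
  assume "det ?M \<noteq> 0"
  then have "invertible ?M" by (simp add: invertible_det_nz)
  moreover have "?M *v c = c $ 1 *s r1 + c $ 2 *s r2 + c $ 3 *s r3 + c $ 4 *s r4 + c $ 5 *s r5"
    by (simp add: vec_eq_iff matrix_vector_mult_def transpose_def sum_5 vector_5 mult.commute)
  ultimately show False
    using assms by (metis invertible_left_inverse matrix_left_invertible_ker)
qed

text \<open>A relation between one vector from each decaying space and the jump vector transfers to
  arbitrary bases. It stays nontrivial because \<open>vm\<close> is a nonzero multiple of the single
  left basis vector. The dimensions 3 and 1 ensure that the list of columns has length five.\<close>

lemma lopatinsky_det_eq_0:
  assumes basis: "is_basis Ep Sp" "is_basis Em Sm" and dim: "vec.dim Sp = 3" "vec.dim Sm = 1"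
    and v: "vp \<in> Sp" "vm \<in> Sm" "vm \<noteq> 0"
    and dep: "A1 a \<gamma> \<beta> Wp *v vp + A1 a \<gamma> \<beta> Wm *v vm +
      k *s (lam *s cvec (flux0 Wp - flux0 Wm) +
         (\<i> * complex_of_real \<xi>) *s cvec (flux2 a \<gamma> \<beta> Wp - flux2 a \<gamma> \<beta> Wm)) = 0"
  shows "lopatinsky_det a \<gamma> \<beta> Wm Wp Ep Em lam \<xi> = 0"
proof -
  obtain e1 e2 e3 where Ep: "Ep = [e1, e2, e3]"
    using is_basis_length[OF basis(1)] dim(1) by (auto simp: numeral_3_eq_3 length_Suc_conv)
  obtain f where Em: "Em = [f]"
    using is_basis_length[OF basis(2)] dim(2) by (auto simp: length_Suc_conv)
  have "vp \<in> vec.span {e1, e2, e3}" "vm \<in> vec.span {f}"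
    using basis v by (auto simp: is_basis_def Ep Em)
  then obtain c1 c2 c3 d where "vp - c1 *s e1 - c2 *s e2 - c3 *s e3 = 0" "vm - d *s f = 0"
    by (auto simp: vec.span_insert vec.span_empty)
  then have vp: "vp = c1 *s e1 + c2 *s e2 + c3 *s e3" and vm: "vm = d *s f"
    by (simp_all add: algebra_simps)
  show ?thesis
    unfolding lopatinsky_det_def Ep Em list.map append.simps
  proof (rule det_columns_dependent[where c = "vector [c1, c2, c3, d, k]"])
    show "(vector [c1, c2, c3, d, k] :: complex^5) \<noteq> 0"
      using v(3) vm by (auto simp: vec_eq_5_iff vector_5)
  qed (use dep in \<open>simp only: vp vm vector_5 matrix_vector_right_distrib vector_scalar_commute\<close>)
qed

text \<open>Reduction to a real linear system for \<open>a1\<close>, \<open>a2\<close>,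
  \<open>a3\<close>, \<open>k\<close>: the phases of the rows are divided out, and rows 4 and 5
  merge into \<open>sys5\<close>. The third vector of the right space, the divergence mode, gets
  coefficient 0 and only enters through the dimension.\<close>

lemma lopatinsky_rootI:
  fixes Cp Cm :: real
  assumes \<rho>: "\<rho>p > 0" "\<rho>m > 0" and C: "Cp = a * \<gamma> * \<rho>p powr (\<gamma> - 1)" "Cm = a * \<gamma> * \<rho>m powr (\<gamma> - 1)"
    and \<beta>: "\<beta> > 0" and sub: "up\<^sup>2 < Cp" and super: "0 < Cm" "Cm < um\<^sup>2"
    and slow: "\<rho>p * up\<^sup>2 < h\<^sup>2" "\<rho>m * um\<^sup>2 < h\<^sup>2"
    and lam: "0 < lam" "lam < up" "lam < um"
    and mass: "\<rho>p * up = \<rho>m * um"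
    and half: "dispersion \<rho>p up Cp h lam (1 / 2) < 0"
    and nonres: "dispersion \<rho>p up Cp h lam (- lam / \<beta>) \<noteq> 0" "dispersion \<rho>m um Cm h lam (- lam / \<beta>) \<noteq> 0"
    and roots: "dispersion \<rho>p up Cp h lam m1 = 0" "m1 < 0" "dispersion \<rho>p up Cp h lam m2 = 0" "m2 < 0"
      "dispersion \<rho>m um Cm h lam m3 = 0" "0 < m3"
    and s: "s1 = lam + m1 * up" "s2 = lam + m2 * up" "s3 = lam + m3 * um"
    and P: "P1 = s1\<^sup>2 - Cp * m1\<^sup>2" "P2 = s2\<^sup>2 - Cp * m2\<^sup>2" "P3 = s3\<^sup>2 - Cm * m3\<^sup>2"
    and a3: "a3 \<noteq> 0"
    and sys1: "a1 * (\<rho>p * s1 * (up * s1 - Cp * m1)) + a2 * (\<rho>p * s2 * (up * s2 - Cp * m2)) +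
      a3 * (\<rho>m * s3 * (um * s3 - Cm * m3)) + k * (lam * (\<rho>p - \<rho>m)) = 0"
    and sys2: "a1 * (\<rho>p * s1 * ((up\<^sup>2 + Cp) * s1 - 2 * up * m1 * Cp)) +
      a2 * (\<rho>p * s2 * ((up\<^sup>2 + Cp) * s2 - 2 * up * m2 * Cp)) +
      a3 * (\<rho>m * s3 * ((um\<^sup>2 + Cm) * s3 - 2 * um * m3 * Cm)) = 0"
    and sys3: "a1 * (P1 * (\<rho>p * up * s1 - h\<^sup>2 * m1)) + a2 * (P2 * (\<rho>p * up * s2 - h\<^sup>2 * m2)) +
      a3 * (P3 * (\<rho>m * um * s3 - h\<^sup>2 * m3)) + k * (pressure a \<gamma> \<rho>p - pressure a \<gamma> \<rho>m) = 0"
    and sys5: "a1 * P1 + a2 * P2 + a3 * P3 = 0"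
  shows "lopatinsky_root a \<gamma> \<beta> (parallel_state \<rho>m um h) (parallel_state \<rho>p up h) lam 1"
proof -
  let ?Wp = "parallel_state \<rho>p up h" and ?Wm = "parallel_state \<rho>m um h"
  let ?Gp = "symbol_matrix a \<gamma> \<beta> ?Wp lam 1" and ?Gm = "symbol_matrix a \<gamma> \<beta> ?Wm lam 1"
  have dim: "vec.dim (decaying_right ?Gp) = 3" "vec.dim (decaying_left ?Gm) = 1"
    using dim_decaying_subsonic[OF \<rho>(1) C(1) \<beta> sub slow(1) lam(1,2) half nonres(1)]
      dim_decaying_supersonic[OF \<rho>(2) C(2) \<beta> super slow(2) lam(1,3) nonres(2)] by blast+
  have Cp: "Cp > 0" using sub by (smt (verit) zero_le_power2)
  have h: "h \<noteq> 0" using \<rho>(1) slow by (auto simp: power2_eq_square mult_less_0_iff)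
  have "invertible (A1 a \<gamma> \<beta> ?Wp)" "invertible (A1 a \<gamma> \<beta> ?Wm)"
    using \<beta> sub super slow
    by (auto intro!: invertible_A1[OF \<rho>(1) C(1)] invertible_A1[OF \<rho>(2) C(2)])
  note eig = this[THEN symbol_matrix_eigenvector]
  have mp: "mode \<rho>p up Cp h lam m \<in> decaying_right ?Gp" if "dispersion \<rho>p up Cp h lam m = 0" "m < 0" for m
    using eig(1)[OF mode_symbol_eq_0[OF \<rho>(1) C(1) that(1)]] that(2)
    by (auto intro: eigenvector_in_decaying_right)
  have mm: "mode \<rho>m um Cm h lam m3 \<in> decaying_left ?Gm"
    using eig(2)[OF mode_symbol_eq_0[OF \<rho>(2) C(2) roots(5)]] roots(6)
    by (auto intro: eigenvector_in_decaying_left)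
  define vp where "vp = complex_of_real a1 *s mode \<rho>p up Cp h lam m1 + complex_of_real a2 *s mode \<rho>p up Cp h lam m2"
  define vm where "vm = complex_of_real a3 *s mode \<rho>m um Cm h lam m3"
  have vp: "vp \<in> decaying_right ?Gp"
    unfolding vp_def using mp roots
    by (intro vec.subspace_add vec.subspace_scale subspace_decaying_right) auto
  have vm: "vm \<in> decaying_left ?Gm" "vm \<noteq> 0"
    unfolding vm_def using mm a3 mode_nonzero[of m3 Cm h \<rho>m um lam] roots(6) super(1) h
    by (auto intro: vec.subspace_scale subspace_decaying_left)
  have sys4: "a1 * (\<beta> * h * P1) + a2 * (\<beta> * h * P2) + a3 * (\<beta> * h * P3) = 0"
    "a1 * (h * lam * P1) + a2 * (h * lam * P2) + a3 * (h * lam * P3) = 0"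
    "a1 * (h\<^sup>2 * P1) + a2 * (h\<^sup>2 * P2) + a3 * (h\<^sup>2 * P3) = 0"
    using sys5 by algebra+
  \<comment> \<open>The true momentum row carries \<open>h\<^sup>2 P\<close> for every mode. These
    terms cancel by \<open>sys5\<close>, which is why \<open>sys2\<close> omits them and stays
    bounded as \<open>h\<close> grows.\<close>
  have sys2': "a1 * (\<rho>p * s1 * ((up\<^sup>2 + Cp) * s1 - 2 * up * m1 * Cp) - h\<^sup>2 * P1) +
      a2 * (\<rho>p * s2 * ((up\<^sup>2 + Cp) * s2 - 2 * up * m2 * Cp) - h\<^sup>2 * P2) +
      a3 * (\<rho>m * s3 * ((um\<^sup>2 + Cm) * s3 - 2 * um * m3 * Cm) - h\<^sup>2 * P3) = 0"
    using sys2 sys5 by algebra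
  have dep: "A1 a \<gamma> \<beta> ?Wp *v vp + A1 a \<gamma> \<beta> ?Wm *v vm +
      complex_of_real k *s (complex_of_real lam *s cvec (flux0 ?Wp - flux0 ?Wm) +
         (\<i> * complex_of_real 1) *s cvec (flux2 a \<gamma> \<beta> ?Wp - flux2 a \<gamma> \<beta> ?Wm)) = 0"
    unfolding vp_def vm_def matrix_vector_right_distrib vector_scalar_commute
      A1_mult_mode[OF \<rho>(1) C(1)] A1_mult_mode[OF \<rho>(2) C(2)] Let_def
      s[symmetric] P[symmetric]
    using sys1 sys2' sys3 sys4 mass
    by (simp add: vec_eq_5_iff vector_5 cvec_def flux0_def flux2_def parallel_state_def Let_def
        complex_eq_iff)
  show ?thesis
    unfolding lopatinsky_root_def Let_def
    using lam(1) dim lopatinsky_det_eq_0[OF _ _ dim vp vm dep] by simp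
qed

section \<open>Fixed points depending on a small parameter\<close>

text \<open>The bound sends a ball of fixed radius about \<open>p0\<close> into the smaller ball of
  radius \<open>K * e\<close>, so Brouwer's theorem applies to every small \<open>e\<close>, and the
  fixed point inherits the bound. \<open>R\<close> collects the open side conditions that must hold
  at the fixed point.\<close>

lemma ex_fixed_point_near:
  fixes \<Phi> :: "real \<times> 'a::euclidean_space \<Rightarrow> 'a"
  assumes cont: "\<forall>\<^sub>F z in nhds (0, p0). isCont \<Phi> z"
    and bound: "\<forall>\<^sub>F z in nhds (0, p0). norm (\<Phi> z - p0) \<le> K * \<bar>fst z\<bar>"
    and R: "\<forall>\<^sub>F z in nhds (0, p0). R z"
  shows "\<forall>\<^sub>F e in at_right 0. \<exists>p. \<Phi> (e, p) = p \<and> norm (p - p0) \<le> K * e \<and> R (e, p)"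
proof -
  obtain d where d: "d > 0" and near: "\<And>z. dist z (0, p0) < d \<Longrightarrow>
      isCont \<Phi> z \<and> norm (\<Phi> z - p0) \<le> K * \<bar>fst z\<bar> \<and> R z"
    using eventually_conj[OF cont eventually_conj[OF bound R]]
    unfolding eventually_nhds_metric by blast
  \<comment> \<open>One half of \<open>d\<close> is reserved for \<open>p\<close>, the other for
    \<open>e\<close>. The second entry keeps \<open>K * e\<close> within the radius; adding 1 to
    \<open>\<bar>K\<bar>\<close> avoids division by 0.\<close>
  define \<delta> where "\<delta> = min (d / 2) (d / 2 / (\<bar>K\<bar> + 1))"
  have \<delta>: "\<delta> > 0" using d by (simp add: \<delta>_def)
  have "\<exists>p. \<Phi> (e, p) = p \<and> norm (p - p0) \<le> K * e \<and> R (e, p)" if e: "0 < e" "e < \<delta>" for e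
  proof -
    have in_ball: "dist (e, p) (0, p0) < d" if "p \<in> cball p0 (d / 2)" for p
    proof -
      have "dist (e, p) (0, p0) \<le> dist e 0 + dist p p0"
        unfolding dist_Pair_Pair by (rule sqrt_sum_squares_le_sum) auto
      also have "\<dots> < d"
        using that e by (simp add: \<delta>_def dist_commute)
      finally show ?thesis .
    qed
    have Ke: "K * e \<le> d / 2"
    proof -
      have "K * e \<le> (\<bar>K\<bar> + 1) * e" using e by (intro mult_right_mono) auto
      also have "\<dots> \<le> d / 2" using e by (simp add: \<delta>_def field_simps)
      finally show ?thesis .
    qed
    have \<Phi>: "norm (\<Phi> (e, p) - p0) \<le> K * e" if "p \<in> cball p0 (d / 2)" for p
      using near[OF in_ball[OF that]] e(1) by simp
    obtain p where p: "p \<in> cball p0 (d / 2)" "\<Phi> (e, p) = p"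
    proof (rule brouwer[of "cball p0 (d / 2)" "\<lambda>p. \<Phi> (e, p)"])
      show "continuous_on (cball p0 (d / 2)) (\<lambda>p. \<Phi> (e, p))"
      proof (rule continuous_at_imp_continuous_on, rule ballI)
        fix p assume "p \<in> cball p0 (d / 2)"
        then have "isCont \<Phi> (e, p)" using near[OF in_ball] by blast
        then show "isCont (\<lambda>p. \<Phi> (e, p)) p"
          by (rule isCont_o2[where f = "Pair e" and g = \<Phi>, rotated]) (intro isCont_Pair continuous_const continuous_ident)
      qed
      show "(\<lambda>p. \<Phi> (e, p)) \<in> cball p0 (d / 2) \<rightarrow> cball p0 (d / 2)"
        using \<Phi> Ke by (force simp: dist_norm norm_minus_commute)
    qed (use d in auto)
    then show ?thesis using \<Phi>[OF p(1)] near[OF in_ball[OF p(1)]] by auto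
  qed
  then show ?thesis
    using \<delta> by (auto simp: eventually_at_right_field)
qed

text \<open>Brouwer's theorem needs continuity on a ball, not just at \<open>z0\<close>. Asking for
  it only near \<open>z0\<close> admits quotients whose denominator is known to be nonzero just at
  \<open>z0\<close>.\<close>

definition continuous_near :: "'a::t2_space \<Rightarrow> ('a \<Rightarrow> 'b::topological_space) \<Rightarrow> bool" where
  "continuous_near z0 f \<longleftrightarrow> (\<forall>\<^sub>F z in nhds z0. isCont f z)"

lemma continuous_nearI: "(\<And>z. isCont f z) \<Longrightarrow> continuous_near z0 f"
  by (simp add: continuous_near_def)

lemma continuous_near_isCont: "continuous_near z0 f \<Longrightarrow> isCont f z0"
  unfolding continuous_near_def by (rule eventually_nhds_x_imp_x)

lemma continuous_near_tendsto: "continuous_near z0 f \<Longrightarrow> (f \<longlongrightarrow> f z0) (nhds z0)"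
  by (drule continuous_near_isCont) (simp add: isCont_def tendsto_at_iff_tendsto_nhds)

lemma continuous_near_nonzero:
  fixes f :: "'a::t2_space \<Rightarrow> 'b::t1_space"
  assumes "continuous_near z0 f" and "f z0 \<noteq> c"
  shows "\<forall>\<^sub>F z in nhds z0. f z \<noteq> c"
  by (rule tendsto_imp_eventually_ne[OF continuous_near_tendsto[OF assms(1)] assms(2)])

lemma continuous_near_less:
  fixes f :: "'a::t2_space \<Rightarrow> real"
  assumes "continuous_near z0 f" and "f z0 < c"
  shows "\<forall>\<^sub>F z in nhds z0. f z < c"
  by (rule order_tendstoD(2)[OF continuous_near_tendsto[OF assms(1)] assms(2)])

lemma continuous_near_greater:
  fixes f :: "'a::t2_space \<Rightarrow> real"
  assumes "continuous_near z0 f" and "c < f z0"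
  shows "\<forall>\<^sub>F z in nhds z0. c < f z"
  by (rule order_tendstoD(1)[OF continuous_near_tendsto[OF assms(1)] assms(2)])

lemma continuous_near_const: "continuous_near z0 (\<lambda>z. c)"
  by (rule continuous_nearI) simp

lemma continuous_near_uminus:
  fixes f :: "'a::t2_space \<Rightarrow> real"
  shows "continuous_near z0 f \<Longrightarrow> continuous_near z0 (\<lambda>z. - f z)"
  unfolding continuous_near_def by (erule eventually_mono) simp

lemma continuous_near_sqrt:
  fixes f :: "'a::t2_space \<Rightarrow> real"
  shows "continuous_near z0 f \<Longrightarrow> continuous_near z0 (\<lambda>z. sqrt (f z))"
  unfolding continuous_near_def by (erule eventually_mono) (rule continuous_real_sqrt)

lemma continuous_near_power:
  fixes f :: "'a::t2_space \<Rightarrow> real"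
  shows "continuous_near z0 f \<Longrightarrow> continuous_near z0 (\<lambda>z. f z ^ n)"
  unfolding continuous_near_def by (erule eventually_mono) simp

lemma continuous_near_binary:
  fixes f g :: "'a::t2_space \<Rightarrow> real"
  assumes "continuous_near z0 f" and "continuous_near z0 g"
  shows continuous_near_add: "continuous_near z0 (\<lambda>z. f z + g z)"
    and continuous_near_diff: "continuous_near z0 (\<lambda>z. f z - g z)"
    and continuous_near_mult: "continuous_near z0 (\<lambda>z. f z * g z)"
  using eventually_conj[OF assms[unfolded continuous_near_def]]
  unfolding continuous_near_def by (auto elim!: eventually_mono)

lemma continuous_near_divide:
  fixes f g :: "'a::t2_space \<Rightarrow> real"
  assumes "continuous_near z0 f" and "continuous_near z0 g" and "g z0 \<noteq> 0"
  shows "continuous_near z0 (\<lambda>z. f z / g z)"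
  using eventually_conj[OF assms(1)[unfolded continuous_near_def]
      eventually_conj[OF assms(2)[unfolded continuous_near_def] continuous_near_nonzero[OF assms(2,3)]]]
  unfolding continuous_near_def by (rule eventually_mono) auto

lemma continuous_near_Pair:
  assumes "continuous_near z0 f" and "continuous_near z0 g"
  shows "continuous_near z0 (\<lambda>z. (f z, g z))"
  using eventually_conj[OF assms[unfolded continuous_near_def]]
  unfolding continuous_near_def by (rule eventually_mono) (auto intro: isCont_Pair)

lemmas continuous_near_intros = continuous_near_const continuous_near_uminus continuous_near_sqrt
  continuous_near_power continuous_near_add continuous_near_diff continuous_near_mult
  continuous_near_divide

text \<open>Requiring a continuous quotient, instead of differentiability, makes the bound
  \<open>f = c + O(e)\<close> in the first coordinate \<open>e\<close> uniform in the remaining ones.\<close>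

definition first_order :: "real \<times> 'a::real_normed_vector \<Rightarrow> (real \<times> 'a \<Rightarrow> real) \<Rightarrow> real \<Rightarrow> bool" where
  "first_order z0 f c \<longleftrightarrow> continuous_near z0 f \<and> fst z0 = 0 \<and>
     (\<exists>g. continuous_near z0 g \<and> (\<forall>\<^sub>F z in nhds z0. f z = c + fst z * g z))"

lemma first_orderE:
  assumes "first_order z0 f c"
  obtains g where "continuous_near z0 g" and "\<forall>\<^sub>F z in nhds z0. f z = c + fst z * g z"
  using assms unfolding first_order_def by blast

lemma first_order_continuous_near: "first_order z0 f c \<Longrightarrow> continuous_near z0 f"
  by (simp add: first_order_def)

lemma first_order_value: "first_order z0 f c \<Longrightarrow> f z0 = c"
  unfolding first_order_def by (auto dest!: eventually_nhds_x_imp_x)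

lemma first_order_cong: "first_order z0 f c \<Longrightarrow> c = d \<Longrightarrow> first_order z0 f d"
  by simp

lemma first_order_bound:
  assumes "first_order z0 f c"
  obtains K where "\<forall>\<^sub>F z in nhds z0. \<bar>f z - c\<bar> \<le> K * \<bar>fst z\<bar>"
proof -
  obtain g where g: "continuous_near z0 g" "\<forall>\<^sub>F z in nhds z0. f z = c + fst z * g z"
    using assms by (rule first_orderE)
  have "continuous_near z0 (\<lambda>z. \<bar>g z\<bar>)"
    using g(1) unfolding continuous_near_def by (rule eventually_mono) (rule continuous_rabs)
  then have "\<forall>\<^sub>F z in nhds z0. \<bar>g z\<bar> < \<bar>g z0\<bar> + 1"
    by (rule continuous_near_less) simp
  then have "\<forall>\<^sub>F z in nhds z0. \<bar>f z - c\<bar> \<le> (\<bar>g z0\<bar> + 1) * \<bar>fst z\<bar>"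
    using g(2)
  proof eventually_elim
    case (elim z)
    then show ?case
      using mult_right_mono[of "\<bar>g z\<bar>" "\<bar>g z0\<bar> + 1" "\<bar>fst z\<bar>"]
      by (simp add: abs_mult mult.commute)
  qed
  then show thesis by (rule that)
qed

lemma continuous_near_fst: "continuous_near z0 (fst :: real \<times> 'a::real_normed_vector \<Rightarrow> real)"
  by (rule continuous_nearI) simp

lemma first_order_plus_fst_times:
  assumes "fst z0 = 0" and "continuous_near z0 g"
  shows "first_order z0 (\<lambda>z. c + fst z * g z) c"
  unfolding first_order_def
  using assms continuous_near_fst[of z0] by (auto intro!: continuous_near_intros exI[of _ g])

lemma first_order_const: "fst z0 = 0 \<Longrightarrow> first_order z0 (\<lambda>z. c) c"
  using first_order_plus_fst_times[of z0 "\<lambda>z. 0" c] by (simp add: continuous_near_const)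

lemma first_order_fst_times:
  assumes "fst z0 = 0" and "continuous_near z0 g"
  shows "first_order z0 (\<lambda>z. fst z * g z) 0"
  using first_order_plus_fst_times[OF assms, of 0] by simp

lemma first_order_fst: "fst z0 = 0 \<Longrightarrow> first_order z0 fst 0"
  using first_order_fst_times[OF _ continuous_near_const, of z0 1] by simp

lemma first_order_add:
  assumes "first_order z0 f c" and "first_order z0 g d"
  shows "first_order z0 (\<lambda>z. f z + g z) (c + d)"
proof -
  obtain f' where f': "continuous_near z0 f'" "\<forall>\<^sub>F z in nhds z0. f z = c + fst z * f' z"
    using assms(1) by (rule first_orderE)
  obtain g' where g': "continuous_near z0 g'" "\<forall>\<^sub>F z in nhds z0. g z = d + fst z * g' z"
    using assms(2) by (rule first_orderE)
  have "\<forall>\<^sub>F z in nhds z0. f z + g z = (c + d) + fst z * (f' z + g' z)"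
    using f'(2) g'(2) by eventually_elim (simp add: algebra_simps)
  then show ?thesis
    using assms f'(1) g'(1) unfolding first_order_def by (blast intro: continuous_near_add)
qed

lemma first_order_mult:
  assumes "first_order z0 f c" and "first_order z0 g d"
  shows "first_order z0 (\<lambda>z. f z * g z) (c * d)"
proof -
  obtain f' where f': "continuous_near z0 f'" "\<forall>\<^sub>F z in nhds z0. f z = c + fst z * f' z"
    using assms(1) by (rule first_orderE)
  obtain g' where g': "continuous_near z0 g'" "\<forall>\<^sub>F z in nhds z0. g z = d + fst z * g' z"
    using assms(2) by (rule first_orderE)
  have "\<forall>\<^sub>F z in nhds z0. f z * g z = c * d + fst z * (f' z * g z + c * g' z)"
    using f'(2) g'(2) by eventually_elim (simp add: algebra_simps)
  moreover have "continuous_near z0 (\<lambda>z. f' z * g z + c * g' z)"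
    using f'(1) g'(1) first_order_continuous_near[OF assms(2)] by (intro continuous_near_intros)
  ultimately show ?thesis
    using assms unfolding first_order_def by (blast intro: continuous_near_mult)
qed

lemma first_order_inverse:
  assumes "first_order z0 f c" and "c \<noteq> 0"
  shows "first_order z0 (\<lambda>z. 1 / f z) (1 / c)"
proof -
  obtain f' where f': "continuous_near z0 f'" "\<forall>\<^sub>F z in nhds z0. f z = c + fst z * f' z"
    using assms(1) by (rule first_orderE)
  note f = first_order_continuous_near[OF assms(1)] first_order_value[OF assms(1)]
  have "\<forall>\<^sub>F z in nhds z0. f z \<noteq> 0"
    using f assms(2) by (intro continuous_near_nonzero) auto
  with f'(2) have "\<forall>\<^sub>F z in nhds z0. 1 / f z = 1 / c + fst z * (- f' z / (c * f z))"
  proof eventually_elim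
    case (elim z)
    have "1 / f z = 1 / c + (c - f z) / (c * f z)"
      using assms(2) elim(2) by (simp add: diff_divide_distrib)
    also have "c - f z = fst z * (- f' z)" using elim by simp
    finally show ?case by simp
  qed
  moreover have "continuous_near z0 (\<lambda>z. - f' z / (c * f z))"
    "continuous_near z0 (\<lambda>z. 1 / f z)"
    using f f'(1) assms(2) by (auto intro!: continuous_near_intros)
  ultimately show ?thesis
    using assms(1) unfolding first_order_def by blast
qed

lemma first_order_uminus: "first_order z0 f c \<Longrightarrow> first_order z0 (\<lambda>z. - f z) (- c)"
  using first_order_mult[OF first_order_const[of z0 "- 1"], of f c]
  by (simp add: first_order_def)

lemma first_order_diff:
  "first_order z0 f c \<Longrightarrow> first_order z0 g d \<Longrightarrow> first_order z0 (\<lambda>z. f z - g z) (c - d)"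
  using first_order_add[OF _ first_order_uminus, of z0 f c g d] by simp

lemma first_order_divide:
  "first_order z0 f c \<Longrightarrow> first_order z0 g d \<Longrightarrow> d \<noteq> 0 \<Longrightarrow> first_order z0 (\<lambda>z. f z / g z) (c / d)"
  using first_order_mult[OF _ first_order_inverse, of z0 f c g d] by simp

lemma first_order_power2: "first_order z0 f c \<Longrightarrow> first_order z0 (\<lambda>z. (f z)\<^sup>2) (c\<^sup>2)"
  unfolding power2_eq_square by (rule first_order_mult)

lemma first_order_sqrt:
  assumes "fst z0 = 0" and "continuous_near z0 g"
  shows "first_order z0 (\<lambda>z. sqrt (1 + fst z * g z)) 1"
proof -
  note c = continuous_near_fst[of z0] assms(2)
  have "\<forall>\<^sub>F z in nhds z0. 0 < 1 + fst z * g z"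
    using c assms(1) by (intro continuous_near_greater continuous_near_intros) auto
  then have "\<forall>\<^sub>F z in nhds z0. sqrt (1 + fst z * g z) = 1 + fst z * (g z / (sqrt (1 + fst z * g z) + 1))"
  proof eventually_elim
    case (elim z)
    \<comment> \<open>Rationalizing the difference from 1 gives the quotient:
      \<open>r - 1 = (r\<^sup>2 - 1) / (r + 1)\<close>.\<close>
    define r where "r = sqrt (1 + fst z * g z)"
    have "r\<^sup>2 = 1 + fst z * g z" "r > 0" using elim by (auto simp: r_def)
    then have "fst z * g z = (r - 1) * (r + 1)" "r + 1 \<noteq> 0"
      by (auto simp: power2_eq_square algebra_simps)
    then show ?case unfolding r_def[symmetric] by (simp add: field_simps)
  qed
  moreover have "sqrt (1 + fst z0 * g z0) + 1 \<noteq> 0" using assms(1) by simp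
  ultimately show ?thesis
    unfolding first_order_def using c assms(1)
    by (auto intro!: exI[of _ "\<lambda>z. g z / (sqrt (1 + fst z * g z) + 1)"] continuous_near_intros)
qed

lemmas first_order_intros = first_order_add first_order_mult first_order_diff first_order_uminus
  first_order_power2

section \<open>The reduced system\<close>

text \<open>Up to common factors, the entries of \<open>A1\<close> applied to a mode. In the second component the
  multiple \<open>h\<^sup>2\<close> of the induction component is removed, and \<open>e = 1 / h\<^sup>2\<close>.\<close>

definition acoustic :: "real \<Rightarrow> real \<Rightarrow> real \<Rightarrow> real" where
  "acoustic C s m = s\<^sup>2 - C * m\<^sup>2"

definition mass_entry :: "real \<Rightarrow> real \<Rightarrow> real \<Rightarrow> real \<Rightarrow> real \<Rightarrow> real" where
  "mass_entry \<rho> u C s m = \<rho> * s * (u * s - C * m)"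

definition momentum_entry :: "real \<Rightarrow> real \<Rightarrow> real \<Rightarrow> real \<Rightarrow> real \<Rightarrow> real" where
  "momentum_entry \<rho> u C s m = \<rho> * s * ((u\<^sup>2 + C) * s - 2 * u * m * C)"

definition transverse_entry :: "real \<Rightarrow> real \<Rightarrow> real \<Rightarrow> real \<Rightarrow> real \<Rightarrow> real \<Rightarrow> real" where
  "transverse_entry e \<rho> u C s m = acoustic C s m * (e * \<rho> * u * s - m)"

lemmas entry_defs = acoustic_def mass_entry_def momentum_entry_def transverse_entry_def

lemma first_order_entries:
  assumes "first_order z0 s cs" and "first_order z0 m cm"
  shows "first_order z0 (\<lambda>z. acoustic C (s z) (m z)) (acoustic C cs cm)"
    and "first_order z0 (\<lambda>z. mass_entry \<rho> u C (s z) (m z)) (mass_entry \<rho> u C cs cm)"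
    and "first_order z0 (\<lambda>z. momentum_entry \<rho> u C (s z) (m z)) (momentum_entry \<rho> u C cs cm)"
    and "first_order z0 (\<lambda>z. transverse_entry (fst z) \<rho> u C (s z) (m z)) (transverse_entry 0 \<rho> u C cs cm)"
proof -
  have z0: "fst z0 = 0" using assms(1) by (simp add: first_order_def)
  note const = first_order_const[OF z0] first_order_fst[OF z0]
  show "first_order z0 (\<lambda>z. acoustic C (s z) (m z)) (acoustic C cs cm)"
    and "first_order z0 (\<lambda>z. mass_entry \<rho> u C (s z) (m z)) (mass_entry \<rho> u C cs cm)"
    and "first_order z0 (\<lambda>z. momentum_entry \<rho> u C (s z) (m z)) (momentum_entry \<rho> u C cs cm)"
    and "first_order z0 (\<lambda>z. transverse_entry (fst z) \<rho> u C (s z) (m z)) (transverse_entry 0 \<rho> u C cs cm)"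
    unfolding entry_defs by (intro first_order_intros assms const)+
qed

text \<open>A root \<open>m\<close> of the dispersion relation near \<open>\<plusminus>1\<close> is a fixed point of
  \<open>m = \<plusminus> sqrt (1 + e \<rho> s\<^sup>2 (1 + C / acoustic C s m))\<close>.\<close>

lemma unit_mode_fixed_point:
  fixes C :: real
  assumes "m\<^sup>2 = 1 + e * (\<rho> * s\<^sup>2 * (1 + C / acoustic C s m))" and "acoustic C s m \<noteq> 0"
  shows "(e * \<rho> * s\<^sup>2 + 1 - m\<^sup>2) * acoustic C s m + e * \<rho> * C * s\<^sup>2 = 0"
  unfolding assms(1) using assms(2) by (simp add: field_simps)

text \<open>The acoustic polynomial factors as \<open>(1 + m * (u - c)) * (1 + m * (u + c))\<close>.
  The second factor vanishes at \<open>- 1 / (u + c)\<close>; solving the relation for that factor,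
  with everything else on the right, gives the fixed point form.\<close>

lemma slow_mode_fixed_point:
  fixes c :: real
  assumes m: "m = - 1 / (u + c) + e * - (\<rho> * c\<^sup>2 * (1 + m * u)\<^sup>2 / (D * (1 + m * (u - c)) * (u + c)))"
    and "u + c \<noteq> 0" and "D \<noteq> 0" and "1 + m * (u - c) \<noteq> 0"
  shows "D * acoustic (c\<^sup>2) (1 + m * u) m + e * \<rho> * c\<^sup>2 * (1 + m * u)\<^sup>2 = 0"
proof -
  define n where "n = \<rho> * c\<^sup>2 * (1 + m * u)\<^sup>2"
  define q where "q = n / (D * (1 + m * (u - c)))"
  have "m * (u + c) = (- 1 / (u + c) + e * - (q / (u + c))) * (u + c)"
    using m unfolding q_def n_def by simp
  also have "\<dots> = - 1 - e * q"
    using assms(2) by (simp add: field_simps)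
  finally have "1 + m * (u + c) = - (e * q)" by simp
  moreover have "D * (1 + m * (u - c)) * q = n"
    using assms(3,4) by (simp add: q_def)
  ultimately have "D * (1 + m * (u - c)) * (1 + m * (u + c)) = - (e * n)"
    by (metis mult.left_commute mult_minus_right)
  moreover have "acoustic (c\<^sup>2) (1 + m * u) m = (1 + m * (u - c)) * (1 + m * (u + c))"
    by (simp add: acoustic_def power2_eq_square algebra_simps)
  ultimately show ?thesis by (simp add: n_def mult.assoc)
qed

text \<open>The coefficients \<open>\<alpha>i\<close> are the cross product of the rows \<open>acoustic\<close> and \<open>momentum_entry\<close>. The last
  component of the map uses the updated values of the other three, so that at \<open>e = 0\<close> the
  map is constant.\<close>

lemma reduced_system_branch:
  fixes \<rho>p \<rho>m up um c Cm dp lam2 :: real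
  assumes pos: "\<rho>p > 0" "\<rho>m > 0" "up > 0" and up_um: "up < um" and sub: "up < c"
    and super: "0 < Cm" "Cm < um\<^sup>2"
    and mass: "\<rho>p * up = \<rho>m * um" and dp: "dp = \<rho>p * up * (um - up)"
    and lam2: "lam2 = dp\<^sup>2 / (2 * (\<rho>p - \<rho>m) * (up + c))"
    and R: "\<forall>\<^sub>F z in nhds (0, lam2). R z"
  obtains K where "\<forall>\<^sub>F e in at_right 0. \<exists>x y w l \<alpha>1 \<alpha>2 \<alpha>3. \<bar>l - lam2\<bar> \<le> K * e \<and> R (e, l) \<and>
    x < 0 \<and> y < 0 \<and> w > 0 \<and> \<alpha>3 \<noteq> 0 \<and>
    (let lam = e * l; s1 = lam + x * up; s2 = 1 + y * up; s3 = lam + w * um in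
      (e * \<rho>p * s1\<^sup>2 + 1 - x\<^sup>2) * acoustic (c\<^sup>2) s1 x + e * \<rho>p * c\<^sup>2 * s1\<^sup>2 = 0 \<and>
      (e * \<rho>p * (lam * s2)\<^sup>2 + 1 - (lam * y)\<^sup>2) * acoustic (c\<^sup>2) s2 y + e * \<rho>p * c\<^sup>2 * s2\<^sup>2 = 0 \<and>
      (e * \<rho>m * s3\<^sup>2 + 1 - w\<^sup>2) * acoustic Cm s3 w + e * \<rho>m * Cm * s3\<^sup>2 = 0 \<and>
      \<alpha>1 * acoustic (c\<^sup>2) s1 x + \<alpha>2 * acoustic (c\<^sup>2) s2 y + \<alpha>3 * acoustic Cm s3 w = 0 \<and>
      \<alpha>1 * momentum_entry \<rho>p up (c\<^sup>2) s1 x + \<alpha>2 * momentum_entry \<rho>p up (c\<^sup>2) s2 y +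
        \<alpha>3 * momentum_entry \<rho>m um Cm s3 w = 0 \<and>
      l * ((\<rho>p - \<rho>m) * (\<alpha>1 * transverse_entry e \<rho>p up (c\<^sup>2) s1 x +
         \<alpha>2 * (lam * transverse_entry e \<rho>p up (c\<^sup>2) s2 y) + \<alpha>3 * transverse_entry e \<rho>m um Cm s3 w)) =
      dp * (\<alpha>1 * mass_entry \<rho>p up (c\<^sup>2) s1 x + \<alpha>2 * mass_entry \<rho>p up (c\<^sup>2) s2 y +
        \<alpha>3 * mass_entry \<rho>m um Cm s3 w))"
proof -
  \<comment> \<open>The acoustic exponent \<open>- lam / (up + c)\<close> divided by
    \<open>lam\<close>.\<close>
  define y0 where "y0 = - 1 / (up + c)"
  define z0 :: "real \<times> real \<times> real \<times> real \<times> real" where "z0 = (0, -1, y0, 1, lam2)"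
  define px where "px = (\<lambda>z :: real \<times> real \<times> real \<times> real \<times> real. fst (snd z))"
  define py where "py = (\<lambda>z :: real \<times> real \<times> real \<times> real \<times> real. fst (snd (snd z)))"
  define pw where "pw = (\<lambda>z :: real \<times> real \<times> real \<times> real \<times> real. fst (snd (snd (snd z))))"
  define pl where "pl = (\<lambda>z :: real \<times> real \<times> real \<times> real \<times> real. snd (snd (snd (snd z))))"
  have z0: "fst z0 = 0" "px z0 = -1" "py z0 = y0" "pw z0 = 1" "pl z0 = lam2"
    by (simp_all add: z0_def px_def py_def pw_def pl_def)
  have cont: "continuous_near z0 px" "continuous_near z0 py" "continuous_near z0 pw" "continuous_near z0 pl"
    unfolding px_def py_def pw_def pl_def by (rule continuous_nearI; simp)+
  note cont = cont continuous_near_fst[of z0]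
  define lam where "lam = (\<lambda>z. fst z * pl z)"
  have lam: "first_order z0 lam 0"
    unfolding lam_def by (rule first_order_fst_times[OF z0(1) cont(4)])
  note cont = cont first_order_continuous_near[OF lam]
  have lam0: "lam z0 = 0" using first_order_value[OF lam] .
  have c: "c > 0" "up + c > 0" using pos sub by auto
  have subsq: "up\<^sup>2 < c\<^sup>2" using pos sub by (simp add: power_strict_mono)
  have um: "um > 0" using pos up_um by simp
  have \<rho>: "\<rho>m < \<rho>p"
  proof -
    have "\<rho>m * up < \<rho>m * um" using pos up_um by simp
    then show ?thesis using mass pos by (metis mult_less_cancel_right_pos)
  qed
  have y0: "y0 < 0" "1 + y0 * up = c / (up + c)" "1 + y0 * (up - c) = 2 * c / (up + c)"
    using c by (auto simp: y0_def field_simps)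

  define A1 where "A1 = (\<lambda>z. acoustic (c\<^sup>2) (lam z + px z * up) (px z))"
  define A3 where "A3 = (\<lambda>z. acoustic Cm (lam z + pw z * um) (pw z))"
  have A: "continuous_near z0 A1" "continuous_near z0 A3"
    unfolding A1_def A3_def acoustic_def by (intro continuous_near_intros cont)+
  have A0: "A1 z0 = up\<^sup>2 - c\<^sup>2" "A3 z0 = um\<^sup>2 - Cm"
    by (simp_all add: A1_def A3_def acoustic_def z0 lam0)
  have A0nz: "A1 z0 \<noteq> 0" "A3 z0 \<noteq> 0" using A0 subsq super by auto
  define g1 where "g1 = (\<lambda>z. \<rho>p * (lam z + px z * up)\<^sup>2 * (1 + c\<^sup>2 / A1 z))"
  define g3 where "g3 = (\<lambda>z. \<rho>m * (lam z + pw z * um)\<^sup>2 * (1 + Cm / A3 z))"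
  have g: "continuous_near z0 g1" "continuous_near z0 g3"
    unfolding g1_def g3_def by (intro continuous_near_intros cont A A0nz)+
  \<comment> \<open>The factor of the acoustic polynomial in the rescaled dispersion relation of the
    second exponent. It equals 1 at \<open>e = 0\<close>, so dividing by it is harmless.\<close>
  define D where "D = (\<lambda>z. fst z * \<rho>p * (lam z * (1 + py z * up))\<^sup>2 + 1 - (lam z * py z)\<^sup>2)"
  have D: "continuous_near z0 D"
    unfolding D_def by (intro continuous_near_intros cont)
  have D0: "D z0 = 1" by (simp add: D_def z0 lam0)
  define g2 where "g2 = (\<lambda>z. - (\<rho>p * c\<^sup>2 * (1 + py z * up)\<^sup>2 / (D z * (1 + py z * (up - c)) * (up + c))))"
  have fac0: "1 + py z0 * (up - c) \<noteq> 0" unfolding z0 y0(3) using c by simp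
  have g2: "continuous_near z0 g2"
    unfolding g2_def using c fac0 by (intro continuous_near_intros cont D) (simp add: D0)

  define X where "X = (\<lambda>z. - sqrt (1 + fst z * g1 z))"
  define Y where "Y = (\<lambda>z. y0 + fst z * g2 z)"
  define W where "W = (\<lambda>z. sqrt (1 + fst z * g3 z))"
  have X: "first_order z0 X (- 1)" and Y: "first_order z0 Y y0" and W: "first_order z0 W 1"
    unfolding X_def Y_def W_def
    by (intro first_order_uminus first_order_sqrt first_order_plus_fst_times z0 g g2)+
  note const = first_order_const[OF z0(1)]
  define S1 where "S1 = (\<lambda>z. lam z + X z * up)"
  define S2 where "S2 = (\<lambda>z. 1 + Y z * up)"
  define S3 where "S3 = (\<lambda>z. lam z + W z * um)"
  have S1: "first_order z0 S1 (- up)"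
    unfolding S1_def by (rule first_order_cong, (rule first_order_intros lam X const)+) simp
  have S2: "first_order z0 S2 (c / (up + c))"
    unfolding S2_def by (rule first_order_cong, (rule first_order_intros Y const)+) (simp add: y0)
  have S3: "first_order z0 S3 um"
    unfolding S3_def by (rule first_order_cong, (rule first_order_intros lam W const)+) simp
  note E1 = first_order_entries[OF S1 X] and E2 = first_order_entries[OF S2 Y]
    and E3 = first_order_entries[OF S3 W]
  define Q where "Q = up\<^sup>2 - c\<^sup>2"
  define Qm where "Qm = um\<^sup>2 - Cm"
  have Qnz: "Q \<noteq> 0" "Qm \<noteq> 0" using subsq super by (auto simp: Q_def Qm_def)
  have v1: "acoustic (c\<^sup>2) (- up) (- 1) = Q" "momentum_entry \<rho>p up (c\<^sup>2) (- up) (- 1) = \<rho>p * up\<^sup>2 * Q"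
    "transverse_entry 0 \<rho>p up (c\<^sup>2) (- up) (- 1) = Q" "mass_entry \<rho>p up (c\<^sup>2) (- up) (- 1) = \<rho>p * up * Q"
    unfolding entry_defs Q_def by (simp_all add: power2_eq_square algebra_simps)
  have v3: "acoustic Cm um 1 = Qm" "momentum_entry \<rho>m um Cm um 1 = \<rho>p * up * um * Qm"
    "transverse_entry 0 \<rho>m um Cm um 1 = - Qm" "mass_entry \<rho>m um Cm um 1 = \<rho>p * up * Qm"
    unfolding entry_defs Qm_def mass by (simp_all add: power2_eq_square algebra_simps)
  \<comment> \<open>\<open>y0\<close> is an exact zero of the acoustic polynomial. In the limit the
    second mode therefore leaves the magnetic row and acts through mass and momentum only.\<close>
  have v2: "acoustic (c\<^sup>2) (c / (up + c)) y0 = 0"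
    "momentum_entry \<rho>p up (c\<^sup>2) (c / (up + c)) y0 = \<rho>p * c\<^sup>2"
    "mass_entry \<rho>p up (c\<^sup>2) (c / (up + c)) y0 = \<rho>p * c\<^sup>2 / (up + c)"
  proof -
    have cy: "c / (up + c) = - (c * y0)" by (simp add: y0_def)
    have y: "y0 * (up + c) = - 1" using c by (simp add: y0_def)
    show "acoustic (c\<^sup>2) (c / (up + c)) y0 = 0"
      unfolding cy acoustic_def by (simp add: power_mult_distrib)
    have "momentum_entry \<rho>p up (c\<^sup>2) (c / (up + c)) y0 = \<rho>p * c\<^sup>2 * (y0 * (up + c))\<^sup>2"
      unfolding cy momentum_entry_def by (simp add: power2_eq_square algebra_simps)
    then show "momentum_entry \<rho>p up (c\<^sup>2) (c / (up + c)) y0 = \<rho>p * c\<^sup>2" by (simp add: y)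
    have "mass_entry \<rho>p up (c\<^sup>2) (c / (up + c)) y0 = \<rho>p * c\<^sup>2 * y0 * (y0 * (up + c))"
      unfolding cy mass_entry_def by (simp add: power2_eq_square algebra_simps)
    then show "mass_entry \<rho>p up (c\<^sup>2) (c / (up + c)) y0 = \<rho>p * c\<^sup>2 / (up + c)"
      by (simp add: y) (simp add: y0_def)
  qed

  define P1 where "P1 = (\<lambda>z. acoustic (c\<^sup>2) (S1 z) (X z))"
  define P2 where "P2 = (\<lambda>z. acoustic (c\<^sup>2) (S2 z) (Y z))"
  define P3 where "P3 = (\<lambda>z. acoustic Cm (S3 z) (W z))"
  define b1 where "b1 = (\<lambda>z. momentum_entry \<rho>p up (c\<^sup>2) (S1 z) (X z))"
  define b2 where "b2 = (\<lambda>z. momentum_entry \<rho>p up (c\<^sup>2) (S2 z) (Y z))"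
  define b3 where "b3 = (\<lambda>z. momentum_entry \<rho>m um Cm (S3 z) (W z))"
  define t1 where "t1 = (\<lambda>z. transverse_entry (fst z) \<rho>p up (c\<^sup>2) (S1 z) (X z))"
  define t2 where "t2 = (\<lambda>z. transverse_entry (fst z) \<rho>p up (c\<^sup>2) (S2 z) (Y z))"
  define t3 where "t3 = (\<lambda>z. transverse_entry (fst z) \<rho>m um Cm (S3 z) (W z))"
  define a1 where "a1 = (\<lambda>z. mass_entry \<rho>p up (c\<^sup>2) (S1 z) (X z))"
  define a2 where "a2 = (\<lambda>z. mass_entry \<rho>p up (c\<^sup>2) (S2 z) (Y z))"
  define a3 where "a3 = (\<lambda>z. mass_entry \<rho>m um Cm (S3 z) (W z))"
  note entries =
    E1(1)[where C = "c\<^sup>2", folded P1_def, unfolded v1]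
    E1(2)[where u = up and \<rho> = \<rho>p and C = "c\<^sup>2", folded a1_def, unfolded v1]
    E1(3)[where u = up and \<rho> = \<rho>p and C = "c\<^sup>2", folded b1_def, unfolded v1]
    E1(4)[where u = up and \<rho> = \<rho>p and C = "c\<^sup>2", folded t1_def, unfolded v1]
    E2(1)[where C = "c\<^sup>2", folded P2_def, unfolded v2]
    E2(2)[where u = up and \<rho> = \<rho>p and C = "c\<^sup>2", folded a2_def, unfolded v2]
    E2(3)[where u = up and \<rho> = \<rho>p and C = "c\<^sup>2", folded b2_def, unfolded v2]
    E2(4)[where u = up and \<rho> = \<rho>p and C = "c\<^sup>2", folded t2_def, unfolded v2]
    E3(1)[where C = "Cm", folded P3_def, unfolded v3]
    E3(2)[where u = um and \<rho> = \<rho>m and C = "Cm", folded a3_def, unfolded v3]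
    E3(3)[where u = um and \<rho> = \<rho>m and C = "Cm", folded b3_def, unfolded v3]
    E3(4)[where u = um and \<rho> = \<rho>m and C = "Cm", folded t3_def, unfolded v3]
  define \<alpha>1 where "\<alpha>1 = (\<lambda>z. P2 z * b3 z - P3 z * b2 z)"
  define \<alpha>2 where "\<alpha>2 = (\<lambda>z. P3 z * b1 z - P1 z * b3 z)"
  define \<alpha>3 where "\<alpha>3 = (\<lambda>z. P1 z * b2 z - P2 z * b1 z)"
  \<comment> \<open>\<open>N\<close> and \<open>T\<close> result from eliminating the coefficient of
    the jump vector between the mass row and the transverse momentum row; the condition to be solved
    is \<open>l * T = N\<close>.\<close>
  define N where "N = (\<lambda>z. dp * (\<alpha>1 z * a1 z + \<alpha>2 z * a2 z + \<alpha>3 z * a3 z))"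
  define T where "T = (\<lambda>z. (\<rho>p - \<rho>m) * (\<alpha>1 z * t1 z + \<alpha>2 z * (lam z * t2 z) + \<alpha>3 z * t3 z))"
  have \<alpha>3: "first_order z0 \<alpha>3 (Q * \<rho>p * c\<^sup>2)"
    unfolding \<alpha>3_def by (rule first_order_cong, (rule first_order_intros entries)+) simp
  \<comment> \<open>In the limit the mass contributions of the two modes at \<plusminus>1 cancel, so
    the acoustic mode alone determines \<open>N\<close>.\<close>
  have N: "first_order z0 N (- (dp\<^sup>2 * (Q * Qm * \<rho>p * c\<^sup>2 / (up + c))))"
    unfolding N_def \<alpha>1_def \<alpha>2_def \<alpha>3_def
    apply (rule first_order_cong, (rule first_order_intros entries const)+)
    unfolding dp by (simp add: algebra_simps power2_eq_square diff_divide_distrib)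
  \<comment> \<open>Here the two modes at \<plusminus>1 add up, which is the origin of the factor 2
    in \<open>lam2\<close>, while the acoustic term carries the factor \<open>lam\<close> and
    disappears.\<close>
  have T: "first_order z0 T (- (2 * (\<rho>p - \<rho>m) * (Q * Qm * \<rho>p * c\<^sup>2)))"
    unfolding T_def \<alpha>1_def \<alpha>2_def \<alpha>3_def
    by (rule first_order_cong, (rule first_order_intros entries const lam)+)
       (simp add: algebra_simps power2_eq_square)
  have Tnz: "- (2 * (\<rho>p - \<rho>m) * (Q * Qm * \<rho>p * c\<^sup>2)) \<noteq> 0"
    using \<rho> Qnz pos c by simp
  define L where "L = (\<lambda>z. N z / T z)"
  have "- (d * (k / m)) / - (2 * r * k) = d / (2 * r * m)" if "k \<noteq> 0" "r \<noteq> 0" "m \<noteq> 0" for d k m r :: real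
    using that by (simp add: field_simps)
  from this[of "Q * Qm * \<rho>p * c\<^sup>2" "\<rho>p - \<rho>m" "up + c" "dp\<^sup>2"]
  have L: "first_order z0 L lam2"
    unfolding L_def lam2 using \<rho> Qnz pos c
    by (intro first_order_cong[OF first_order_divide[OF N T Tnz]]) simp

  define \<Phi> where "\<Phi> = (\<lambda>z. (X z, Y z, W z, L z))"
  define p0 where "p0 = (- 1 :: real, y0, 1 :: real, lam2)"
  have z0': "z0 = (0, p0)" by (simp add: z0_def p0_def)
  obtain K1 where K1: "\<forall>\<^sub>F z in nhds z0. \<bar>X z - - 1\<bar> \<le> K1 * \<bar>fst z\<bar>" using first_order_bound[OF X] .
  obtain K2 where K2: "\<forall>\<^sub>F z in nhds z0. \<bar>Y z - y0\<bar> \<le> K2 * \<bar>fst z\<bar>" using first_order_bound[OF Y] .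
  obtain K3 where K3: "\<forall>\<^sub>F z in nhds z0. \<bar>W z - 1\<bar> \<le> K3 * \<bar>fst z\<bar>" using first_order_bound[OF W] .
  obtain K4 where K4: "\<forall>\<^sub>F z in nhds z0. \<bar>L z - lam2\<bar> \<le> K4 * \<bar>fst z\<bar>" using first_order_bound[OF L] .
  define K where "K = K1 + (K2 + (K3 + K4))"
  have bound: "\<forall>\<^sub>F z in nhds (0, p0). norm (\<Phi> z - p0) \<le> K * \<bar>fst z\<bar>"
    using K1 K2 K3 K4 unfolding z0'
  proof eventually_elim
    case (elim z)
    have "norm (\<Phi> z - p0) \<le> \<bar>X z - - 1\<bar> + (\<bar>Y z - y0\<bar> + (\<bar>W z - 1\<bar> + \<bar>L z - lam2\<bar>))"
      using norm_Pair_le[of "X z - - 1" "(Y z - y0, W z - 1, L z - lam2)"]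
        norm_Pair_le[of "Y z - y0" "(W z - 1, L z - lam2)"] norm_Pair_le[of "W z - 1" "L z - lam2"]
      by (simp add: \<Phi>_def p0_def)
    also have "\<dots> \<le> K * \<bar>fst z\<bar>"
      using elim by (simp add: K_def algebra_simps)
    finally show ?case .
  qed
  have cont\<Phi>: "\<forall>\<^sub>F z in nhds (0, p0). isCont \<Phi> z"
    unfolding z0'[symmetric] continuous_near_def[symmetric] \<Phi>_def
    by (intro continuous_near_Pair first_order_continuous_near[OF X] first_order_continuous_near[OF Y]
        first_order_continuous_near[OF W] first_order_continuous_near[OF L])
  have "((\<lambda>z. (fst z, pl z)) \<longlongrightarrow> (0, lam2)) (nhds z0)"
    using continuous_near_tendsto[OF continuous_near_Pair[OF cont(5) cont(4)]] by (simp add: z0)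
  then have R': "\<forall>\<^sub>F z in nhds z0. R (fst z, pl z)"
    using R by (rule eventually_compose_filterlim[rotated])
  \<comment> \<open>Besides signs, these conditions permit undoing the construction of the map:
    denominators are nonzero, and radicands are positive, so that squaring \<open>X\<close> and
    \<open>W\<close> recovers the dispersion relations.\<close>
  have ev: "\<forall>\<^sub>F z in nhds z0. R (fst z, pl z) \<and> X z < 0 \<and> Y z < 0 \<and> 0 < W z \<and> \<alpha>3 z \<noteq> 0 \<and> T z \<noteq> 0 \<and>
      A1 z \<noteq> 0 \<and> A3 z \<noteq> 0 \<and> D z \<noteq> 0 \<and> 1 + py z * (up - c) \<noteq> 0 \<and> - 1 < fst z * g1 z \<and> - 1 < fst z * g3 z"
    using first_order_value[OF X] first_order_value[OF Y] first_order_value[OF W]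
      first_order_value[OF \<alpha>3] first_order_value[OF T] Tnz A0nz D0 fac0 y0 Qnz pos c z0(1)
    by (intro eventually_conj R' continuous_near_less[where f = X] continuous_near_less[where f = Y]
        continuous_near_greater[where f = W] continuous_near_nonzero[where f = \<alpha>3]
        continuous_near_nonzero[where f = T] continuous_near_nonzero[where f = A1]
        continuous_near_nonzero[where f = A3] continuous_near_nonzero[where f = D]
        continuous_near_nonzero[where f = "\<lambda>z. 1 + py z * (up - c)"]
        continuous_near_greater[where f = "\<lambda>z. fst z * g1 z"]
        continuous_near_greater[where f = "\<lambda>z. fst z * g3 z"]
        first_order_continuous_near[OF X] first_order_continuous_near[OF Y]
        first_order_continuous_near[OF W] first_order_continuous_near[OF \<alpha>3]
        first_order_continuous_near[OF T] continuous_near_intros A D g cont) auto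
  show thesis
  proof (rule that[of K], rule eventually_mono[OF ex_fixed_point_near[OF cont\<Phi> bound ev[unfolded z0']]],
      elim exE conjE, goal_cases)
    case (1 e p)
    obtain x y w l where p: "p = (x, y, w, l)" by (cases p) auto
    let ?z = "(e, p)"
    have proj: "px ?z = x" "py ?z = y" "pw ?z = w" "pl ?z = l" "lam ?z = e * l"
      by (simp_all add: p px_def py_def pw_def pl_def lam_def)
    have fixp: "X ?z = x" "Y ?z = y" "W ?z = w" "L ?z = l"
      using 1(1) by (simp_all add: \<Phi>_def p)
    have S: "S1 ?z = e * l + x * up" "S2 ?z = 1 + y * up" "S3 ?z = e * l + w * um"
      by (simp_all add: S1_def S2_def S3_def fixp proj)
    have "\<bar>l - lam2\<bar> \<le> norm (p - p0)"
    proof -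
      have "\<bar>l - lam2\<bar> \<le> norm (w - 1, l - lam2)" using norm_snd_le[of "l - lam2" "w - 1"] by simp
      also have "\<dots> \<le> norm (y - y0, w - 1, l - lam2)" using norm_snd_le[of "(w - 1, l - lam2)" "y - y0"] by simp
      also have "\<dots> \<le> norm (x + 1, y - y0, w - 1, l - lam2)" using norm_snd_le[of "(y - y0, w - 1, l - lam2)" "x + 1"] by simp
      finally show ?thesis by (simp add: p p0_def)
    qed
    then have close: "\<bar>l - lam2\<bar> \<le> K * e" using 1(2) by simp
    have "x\<^sup>2 = 1 + e * g1 ?z" using fixp(1) 1 by (auto simp: X_def)
    then have disp1: "(e * \<rho>p * (e * l + x * up)\<^sup>2 + 1 - x\<^sup>2) * acoustic (c\<^sup>2) (e * l + x * up) x +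
        e * \<rho>p * c\<^sup>2 * (e * l + x * up)\<^sup>2 = 0"
      using 1 by (intro unit_mode_fixed_point) (simp_all add: g1_def A1_def proj)
    have "w\<^sup>2 = 1 + e * g3 ?z" using fixp(3) 1 by (auto simp: W_def)
    then have disp3: "(e * \<rho>m * (e * l + w * um)\<^sup>2 + 1 - w\<^sup>2) * acoustic Cm (e * l + w * um) w +
        e * \<rho>m * Cm * (e * l + w * um)\<^sup>2 = 0"
      using 1 by (intro unit_mode_fixed_point) (simp_all add: g3_def A3_def proj)
    have "D ?z * acoustic (c\<^sup>2) (1 + y * up) y + e * \<rho>p * c\<^sup>2 * (1 + y * up)\<^sup>2 = 0"
      using fixp(2) 1 c unfolding Y_def g2_def y0_def proj
      by (intro slow_mode_fixed_point) (auto simp: proj)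
    then have disp2: "(e * \<rho>p * (e * l * (1 + y * up))\<^sup>2 + 1 - (e * l * y)\<^sup>2) * acoustic (c\<^sup>2) (1 + y * up) y +
        e * \<rho>p * c\<^sup>2 * (1 + y * up)\<^sup>2 = 0"
      by (simp add: D_def proj)
    have P: "\<alpha>1 ?z * P1 ?z + \<alpha>2 ?z * P2 ?z + \<alpha>3 ?z * P3 ?z = 0"
      and b: "\<alpha>1 ?z * b1 ?z + \<alpha>2 ?z * b2 ?z + \<alpha>3 ?z * b3 ?z = 0"
      by (simp_all add: \<alpha>1_def \<alpha>2_def \<alpha>3_def algebra_simps)
    have "l = N ?z / T ?z" using fixp(4) by (simp add: L_def)
    then have LT: "l * T ?z = N ?z" using 1 by simp
    have signs: "R (e, l)" "x < 0" "y < 0" "0 < w" "\<alpha>3 ?z \<noteq> 0"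
      using 1 by (simp_all add: fixp proj)
    show ?case
      unfolding Let_def
      by (intro exI[of _ x] exI[of _ y] exI[of _ w] exI[of _ l]
          exI[of _ "\<alpha>1 ?z"] exI[of _ "\<alpha>2 ?z"] exI[of _ "\<alpha>3 ?z"] conjI close signs disp1 disp2 disp3
          P[unfolded P1_def P2_def P3_def fixp S] b[unfolded b1_def b2_def b3_def fixp S]
          LT[unfolded T_def N_def t1_def t2_def t3_def a1_def a2_def a3_def fixp S proj fst_conv])
  qed
qed

section \<open>The unstable root\<close>

lemma dispersion_scaled:
  assumes "h\<^sup>2 = 1 / e" and "e \<noteq> 0"
  shows "dispersion \<rho> u C h lam m =
    ((e * \<rho> * (lam + m * u)\<^sup>2 + 1 - m\<^sup>2) * acoustic C (lam + m * u) m + e * \<rho> * C * (lam + m * u)\<^sup>2) / e"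
  unfolding dispersion_def acoustic_def assms(1) using assms(2) by (simp add: field_simps)

text \<open>For the exponent \<open>lam * y\<close> both \<open>s\<close> and \<mu> are proportional
  to \<open>lam\<close>. Extracting \<open>lam\<^sup>2\<close> leaves a bracket that stays regular
  as \<open>lam\<close> tends to 0.\<close>

lemma dispersion_scaled_slow:
  assumes "h\<^sup>2 = 1 / e" and "e \<noteq> 0"
  shows "dispersion \<rho> u C h lam (lam * y) =
    lam\<^sup>2 * ((e * \<rho> * (lam * (1 + y * u))\<^sup>2 + 1 - (lam * y)\<^sup>2) * acoustic C (1 + y * u) y +
      e * \<rho> * C * (1 + y * u)\<^sup>2) / e"
proof -
  obtain s where s: "s = 1 + y * u" by simp
  have "lam + lam * y * u = lam * s" by (simp add: s algebra_simps)
  moreover have "acoustic C (lam * s) (lam * y) = lam\<^sup>2 * acoustic C s y"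
    by (simp add: acoustic_def power_mult_distrib algebra_simps)
  ultimately show ?thesis
    unfolding dispersion_scaled[OF assms] s[symmetric] by (simp add: power_mult_distrib algebra_simps)
qed

text \<open>If \<open>- lam / \<beta>\<close> is itself an acoustic exponent to leading order, the remaining term
  \<open>\<rho> C s\<^sup>2\<close> of the dispersion relation does not vanish.\<close>

lemma eventually_nonresonant:
  fixes C :: real
  assumes "\<rho> > 0" and "C > 0" and "\<beta> > 0"
  shows "\<forall>\<^sub>F z in nhds (0, l0). \<forall>h. 0 < fst z \<longrightarrow> 0 < snd z \<longrightarrow> h\<^sup>2 = 1 / fst z \<longrightarrow>
    dispersion \<rho> u C h (fst z * snd z) (- (fst z * snd z) / \<beta>) \<noteq> 0"
proof -
  define y where "y = - 1 / \<beta>"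
  define s where "s = 1 + y * u"
  define G where "G = (\<lambda>z :: real \<times> real. (fst z * \<rho> * (fst z * snd z * s)\<^sup>2 + 1 - (fst z * snd z * y)\<^sup>2) * acoustic C s y +
      fst z * \<rho> * C * s\<^sup>2)"
  have y: "y \<noteq> 0" using assms by (simp add: y_def)
  have "\<forall>\<^sub>F z in nhds (0, l0). 0 < fst z \<longrightarrow> G z \<noteq> 0"
  proof (cases "acoustic C s y = 0")
    case True
    then have "s \<noteq> 0" using assms y by (auto simp: acoustic_def)
    then show ?thesis using assms True by (simp add: G_def)
  next
    case False
    have "continuous_near (0, l0) (snd :: real \<times> real \<Rightarrow> real)" by (rule continuous_nearI) simp
    then have "continuous_near (0, l0) G"
      unfolding G_def by (intro continuous_near_intros continuous_near_fst)
    then have "\<forall>\<^sub>F z in nhds (0, l0). G z \<noteq> 0"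
      by (rule continuous_near_nonzero) (use False in \<open>simp add: G_def\<close>)
    then show ?thesis by (rule eventually_mono) simp
  qed
  then show ?thesis
  proof (rule eventually_mono, intro allI impI)
    fix z :: "real \<times> real" and h
    assume G: "0 < fst z \<longrightarrow> G z \<noteq> 0" and z: "0 < fst z" "0 < snd z" and h: "h\<^sup>2 = 1 / fst z"
    have "- (fst z * snd z) / \<beta> = (fst z * snd z) * y" by (simp add: y_def)
    then have "dispersion \<rho> u C h (fst z * snd z) (- (fst z * snd z) / \<beta>) = (fst z * snd z)\<^sup>2 * G z / fst z"
      using dispersion_scaled_slow[OF h] z(1) by (simp only: G_def s_def)
    then show "dispersion \<rho> u C h (fst z * snd z) (- (fst z * snd z) / \<beta>) \<noteq> 0"
      using G z by simp
  qed
qed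

text \<open>Translates the rescaled solution branch back into the determinant. One \<open>l\<close>
  serves both signs of \<open>h\<close>, because the real system contains only
  \<open>h\<^sup>2\<close>.\<close>

lemma lopatinsky_roots_near:
  fixes \<rho>p \<rho>m up um c Cm dp lam2 :: real
  assumes pos: "\<rho>p > 0" "\<rho>m > 0" "up > 0" and up_um: "up < um" and \<beta>: "\<beta> > 0"
    and c: "c > 0" "c\<^sup>2 = a * \<gamma> * \<rho>p powr (\<gamma> - 1)" and sub: "up < c"
    and Cm: "Cm = a * \<gamma> * \<rho>m powr (\<gamma> - 1)" and super: "0 < Cm" "Cm < um\<^sup>2"
    and mass: "\<rho>p * up = \<rho>m * um"
    and dp: "pressure a \<gamma> \<rho>p - pressure a \<gamma> \<rho>m = \<rho>p * up * (um - up)"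
    and lam2: "lam2 = (\<rho>p * up * (um - up))\<^sup>2 / (2 * (\<rho>p - \<rho>m) * (up + c))" "lam2 > 0"
  obtains K where "\<forall>\<^sub>F e in at_right 0. \<exists>l. \<bar>l - lam2\<bar> \<le> K * e \<and>
    (\<forall>h. h\<^sup>2 = 1 / e \<longrightarrow> \<rho>m * um\<^sup>2 < h\<^sup>2 \<and>
      lopatinsky_root a \<gamma> \<beta> (parallel_state \<rho>m um h) (parallel_state \<rho>p up h) (complex_of_real (e * l)) 1)"
proof -
  \<comment> \<open>This is \<open>e\<close> times the dispersion polynomial at
    \<open>1 / 2\<close>. At \<open>e = 0\<close> it becomes
    \<open>3 / 16 * (up\<^sup>2 - c\<^sup>2)\<close>, negative on the subsonic side.\<close>
  define half where "half = (\<lambda>z :: real \<times> real.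
    (fst z * \<rho>p * (fst z * snd z + 1 / 2 * up)\<^sup>2 + 1 - (1 / 2)\<^sup>2) * acoustic (c\<^sup>2) (fst z * snd z + 1 / 2 * up) (1 / 2)
      + fst z * \<rho>p * c\<^sup>2 * (fst z * snd z + 1 / 2 * up)\<^sup>2)"
  define R where "R = (\<lambda>z :: real \<times> real. 0 < snd z \<and> fst z * snd z < up \<and> fst z * (\<rho>p * up\<^sup>2) < 1 \<and>
    fst z * (\<rho>m * um\<^sup>2) < 1 \<and> half z < 0 \<and>
    (\<forall>h. 0 < fst z \<longrightarrow> 0 < snd z \<longrightarrow> h\<^sup>2 = 1 / fst z \<longrightarrow>
      dispersion \<rho>p up (c\<^sup>2) h (fst z * snd z) (- (fst z * snd z) / \<beta>) \<noteq> 0) \<and>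
    (\<forall>h. 0 < fst z \<longrightarrow> 0 < snd z \<longrightarrow> h\<^sup>2 = 1 / fst z \<longrightarrow>
      dispersion \<rho>m um Cm h (fst z * snd z) (- (fst z * snd z) / \<beta>) \<noteq> 0))"
  have subsq: "up\<^sup>2 < c\<^sup>2" using pos sub by (simp add: power_strict_mono)
  have cont: "continuous_near (0, lam2) (snd :: real \<times> real \<Rightarrow> real)"
    "continuous_near (0, lam2) (fst :: real \<times> real \<Rightarrow> real)"
    by (rule continuous_nearI; simp)+
  have half: "continuous_near (0, lam2) half"
    unfolding half_def acoustic_def by (intro continuous_near_intros cont) simp_all
  have half0: "half (0, lam2) < 0"
    using subsq by (simp add: half_def acoustic_def power_mult_distrib power2_eq_square)
  have ev: "\<forall>\<^sub>F z in nhds (0, lam2). R z"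
    unfolding R_def using lam2(2) pos half0
    by (intro eventually_conj eventually_nonresonant continuous_near_less half continuous_near_intros cont
        continuous_near_greater pos \<beta> super zero_less_power c) simp_all
  obtain K where K: "\<forall>\<^sub>F e in at_right 0. \<exists>x y w l \<alpha>1 \<alpha>2 \<alpha>3. \<bar>l - lam2\<bar> \<le> K * e \<and> R (e, l) \<and>
    x < 0 \<and> y < 0 \<and> w > 0 \<and> \<alpha>3 \<noteq> 0 \<and>
    (let lam = e * l; s1 = lam + x * up; s2 = 1 + y * up; s3 = lam + w * um in
      (e * \<rho>p * s1\<^sup>2 + 1 - x\<^sup>2) * acoustic (c\<^sup>2) s1 x + e * \<rho>p * c\<^sup>2 * s1\<^sup>2 = 0 \<and>
      (e * \<rho>p * (lam * s2)\<^sup>2 + 1 - (lam * y)\<^sup>2) * acoustic (c\<^sup>2) s2 y + e * \<rho>p * c\<^sup>2 * s2\<^sup>2 = 0 \<and>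
      (e * \<rho>m * s3\<^sup>2 + 1 - w\<^sup>2) * acoustic Cm s3 w + e * \<rho>m * Cm * s3\<^sup>2 = 0 \<and>
      \<alpha>1 * acoustic (c\<^sup>2) s1 x + \<alpha>2 * acoustic (c\<^sup>2) s2 y + \<alpha>3 * acoustic Cm s3 w = 0 \<and>
      \<alpha>1 * momentum_entry \<rho>p up (c\<^sup>2) s1 x + \<alpha>2 * momentum_entry \<rho>p up (c\<^sup>2) s2 y +
        \<alpha>3 * momentum_entry \<rho>m um Cm s3 w = 0 \<and>
      l * ((\<rho>p - \<rho>m) * (\<alpha>1 * transverse_entry e \<rho>p up (c\<^sup>2) s1 x +
         \<alpha>2 * (lam * transverse_entry e \<rho>p up (c\<^sup>2) s2 y) + \<alpha>3 * transverse_entry e \<rho>m um Cm s3 w)) =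
      (\<rho>p * up * (um - up)) * (\<alpha>1 * mass_entry \<rho>p up (c\<^sup>2) s1 x + \<alpha>2 * mass_entry \<rho>p up (c\<^sup>2) s2 y +
        \<alpha>3 * mass_entry \<rho>m um Cm s3 w))"
    using reduced_system_branch[OF pos up_um sub super mass refl lam2(1) ev] by blast
  have \<rho>: "\<rho>p - \<rho>m \<noteq> 0" using lam2 by auto
  show thesis
  proof (rule that[of K], rule eventually_mono[OF eventually_conj[OF K eventually_at_right_less]],
      unfold Let_def, elim exE conjE, intro exI conjI allI impI, assumption, goal_cases)
    case (1 e x y w l \<alpha>1 \<alpha>2 \<alpha>3 h)
    then have "e * (\<rho>m * um\<^sup>2) < 1" by (simp add: R_def)
    then have "\<rho>m * um\<^sup>2 < 1 / e" using \<open>0 < e\<close> by (simp add: field_simps)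
    then show ?case using \<open>h\<^sup>2 = 1 / e\<close> by simp
  next
    case (2 e x y w l \<alpha>1 \<alpha>2 \<alpha>3 h)
    note e = \<open>0 < e\<close> and h = \<open>h\<^sup>2 = 1 / e\<close>
    have R: "0 < l" "e * l < up" "e * (\<rho>p * up\<^sup>2) < 1" "e * (\<rho>m * um\<^sup>2) < 1" "half (e, l) < 0"
      "dispersion \<rho>p up (c\<^sup>2) h (e * l) (- (e * l) / \<beta>) \<noteq> 0"
      "dispersion \<rho>m um Cm h (e * l) (- (e * l) / \<beta>) \<noteq> 0"
      using \<open>R (e, l)\<close> e h by (auto simp: R_def)
    define lam where "lam = e * l"
    have lam: "lam > 0" "lam < up" "lam < um" using R e up_um by (auto simp: lam_def)
    define T where "T = \<alpha>1 * transverse_entry e \<rho>p up (c\<^sup>2) (lam + x * up) x +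
         \<alpha>2 * (lam * transverse_entry e \<rho>p up (c\<^sup>2) (1 + y * up) y) + \<alpha>3 * transverse_entry e \<rho>m um Cm (lam + w * um) w"
    define N where "N = \<alpha>1 * mass_entry \<rho>p up (c\<^sup>2) (lam + x * up) x + \<alpha>2 * mass_entry \<rho>p up (c\<^sup>2) (1 + y * up) y +
        \<alpha>3 * mass_entry \<rho>m um Cm (lam + w * um) w"
    have NT: "l * ((\<rho>p - \<rho>m) * T) = (\<rho>p * up * (um - up)) * N"
      using 2 unfolding T_def N_def lam_def by blast
    have s2: "lam * (1 + y * up) = lam + lam * y * up" by (simp add: algebra_simps)
    have e_nz: "e \<noteq> 0" using e by simp
    show ?case
      unfolding lam_def[symmetric]
    \<comment> \<open>Dividing \<open>\<alpha>2\<close> by \<open>lam\<^sup>2\<close> compensates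
      the scaling of the acoustic mode, and \<open>k\<close> is chosen so that the mass row
      vanishes.\<close>
    proof (rule lopatinsky_rootI[where ?m1.0 = x and ?m2.0 = "lam * y" and ?m3.0 = w and ?a1.0 = \<alpha>1
          and ?a2.0 = "\<alpha>2 / lam\<^sup>2" and ?a3.0 = \<alpha>3 and k = "- N / (lam * (\<rho>p - \<rho>m))"
          and Cp = "c\<^sup>2" and Cm = Cm, OF pos(1,2) c(2) Cm \<beta> subsq super _ _ lam mass _ _ _ _ _ _ _ _ _
          refl s2 refl refl refl refl])
      show "\<rho>p * up\<^sup>2 < h\<^sup>2" "\<rho>m * um\<^sup>2 < h\<^sup>2"
        unfolding h using R e by (simp_all add: field_simps)
      show "dispersion \<rho>p up (c\<^sup>2) h lam (1 / 2) < 0"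
        unfolding dispersion_scaled[OF h e_nz] using R(5) e
        by (simp add: half_def lam_def divide_neg_pos)
      show "dispersion \<rho>p up (c\<^sup>2) h lam (- lam / \<beta>) \<noteq> 0" "dispersion \<rho>m um Cm h lam (- lam / \<beta>) \<noteq> 0"
        using R by (simp_all add: lam_def)
      show "dispersion \<rho>p up (c\<^sup>2) h lam x = 0" "dispersion \<rho>m um Cm h lam w = 0"
        unfolding dispersion_scaled[OF h e_nz] using 2 by (simp_all add: lam_def)
      show "dispersion \<rho>p up (c\<^sup>2) h lam (lam * y) = 0"
        unfolding dispersion_scaled_slow[OF h e_nz] using 2 by (simp add: lam_def)
      show "x < 0" "lam * y < 0" "0 < w" "\<alpha>3 \<noteq> 0"
        using 2 lam by (simp_all add: mult_pos_neg)
      have scale: "acoustic (c\<^sup>2) (lam * s) (lam * y) = lam\<^sup>2 * acoustic (c\<^sup>2) s y"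
        "mass_entry \<rho>p up (c\<^sup>2) (lam * s) (lam * y) = lam\<^sup>2 * mass_entry \<rho>p up (c\<^sup>2) s y"
        "momentum_entry \<rho>p up (c\<^sup>2) (lam * s) (lam * y) = lam\<^sup>2 * momentum_entry \<rho>p up (c\<^sup>2) s y" for s
        by (simp_all add: entry_defs power2_eq_square algebra_simps)
      have lam_nz: "lam \<noteq> 0" using lam by simp
      show "\<alpha>1 * (\<rho>p * (lam + x * up) * (up * (lam + x * up) - c\<^sup>2 * x)) +
        \<alpha>2 / lam\<^sup>2 * (\<rho>p * (lam * (1 + y * up)) * (up * (lam * (1 + y * up)) - c\<^sup>2 * (lam * y))) +
        \<alpha>3 * (\<rho>m * (lam + w * um) * (um * (lam + w * um) - Cm * w)) +
        - N / (lam * (\<rho>p - \<rho>m)) * (lam * (\<rho>p - \<rho>m)) = 0"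
        unfolding mass_entry_def[symmetric] scale using lam_nz \<rho> by (simp add: N_def)
      show "\<alpha>1 * (\<rho>p * (lam + x * up) * ((up\<^sup>2 + c\<^sup>2) * (lam + x * up) - 2 * up * x * c\<^sup>2)) +
        \<alpha>2 / lam\<^sup>2 * (\<rho>p * (lam * (1 + y * up)) * ((up\<^sup>2 + c\<^sup>2) * (lam * (1 + y * up)) - 2 * up * (lam * y) * c\<^sup>2)) +
        \<alpha>3 * (\<rho>m * (lam + w * um) * ((um\<^sup>2 + Cm) * (lam + w * um) - 2 * um * w * Cm)) = 0"
        unfolding momentum_entry_def[symmetric] scale using lam_nz 2 by (simp add: lam_def)
      show "\<alpha>1 * ((lam + x * up)\<^sup>2 - c\<^sup>2 * x\<^sup>2) + \<alpha>2 / lam\<^sup>2 * ((lam * (1 + y * up))\<^sup>2 - c\<^sup>2 * (lam * y)\<^sup>2) +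
        \<alpha>3 * ((lam + w * um)\<^sup>2 - Cm * w\<^sup>2) = 0"
        unfolding acoustic_def[symmetric] scale using lam_nz 2 by (simp add: lam_def)
      have tr: "acoustic C s m * (\<rho> * u * s - h\<^sup>2 * m) = transverse_entry e \<rho> u C s m / e" for C s m \<rho> u
        unfolding h transverse_entry_def using e_nz by (simp add: field_simps)
      have tr2: "transverse_entry e \<rho>p up (c\<^sup>2) (lam * s) (lam * y) = lam\<^sup>2 * (lam * transverse_entry e \<rho>p up (c\<^sup>2) s y)" for s
        unfolding transverse_entry_def scale by (simp add: algebra_simps)
      \<comment> \<open>With \<open>k\<close> fixed by the mass row, the transverse row becomes
        exactly \<open>NT\<close>, because \<open>lam = e * l\<close> and
        \<open>h\<^sup>2 = 1 / e\<close>.\<close>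
      have "N * (\<rho>p * up * (um - up)) / (lam * (\<rho>p - \<rho>m)) = l * ((\<rho>p - \<rho>m) * T) / (e * l * (\<rho>p - \<rho>m))"
        unfolding lam_def NT by (simp only: mult.commute[of N])
      also have "\<dots> = T / e"
        using R(1) \<rho> by simp
      finally have "N * (\<rho>p * up * (um - up)) / (lam * (\<rho>p - \<rho>m)) = T / e" .
      then show "\<alpha>1 * (((lam + x * up)\<^sup>2 - c\<^sup>2 * x\<^sup>2) * (\<rho>p * up * (lam + x * up) - h\<^sup>2 * x)) +
        \<alpha>2 / lam\<^sup>2 * (((lam * (1 + y * up))\<^sup>2 - c\<^sup>2 * (lam * y)\<^sup>2) * (\<rho>p * up * (lam * (1 + y * up)) - h\<^sup>2 * (lam * y))) +
        \<alpha>3 * (((lam + w * um)\<^sup>2 - Cm * w\<^sup>2) * (\<rho>m * um * (lam + w * um) - h\<^sup>2 * w)) +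
        - N / (lam * (\<rho>p - \<rho>m)) * (pressure a \<gamma> \<rho>p - pressure a \<gamma> \<rho>m) = 0"
        unfolding acoustic_def[symmetric] tr tr2 dp using lam_nz
        by (simp add: T_def add_divide_distrib)
    qed
  qed
qed

section \<open>Lax inequalities of the gas-dynamical shock\<close>

lemma ln_less_self_minus_1: "x > 1 \<Longrightarrow> ln x < x - (1::real)"
  using ln_le_minus_one[of x] ln_eq_minus_one[of x] by fastforce

text \<open>The jump relations turn subsonic flow on the right into
  \<open>y - 1 < y * \<gamma> * (R - 1)\<close> and supersonic flow on the left into
  \<open>\<gamma> * (R - 1) < R * (y - 1)\<close>, where \<open>y = R powr \<gamma>\<close>. Both
  follow by comparison through \<open>ln y = \<gamma> * ln R\<close>, with strictness coming from
  the bounds on \<open>ln R\<close>.\<close>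

lemma gas_shock_facts:
  fixes \<gamma> a \<rho>p \<rho>m up um R :: real
  assumes "\<gamma> \<ge> 1" and "a > 0" and "\<rho>p > 0" and "\<rho>m > 0" and "0 < up" and "up < um"
    and mass: "\<rho>p * up = \<rho>m * um"
    and mom: "\<rho>p * up^2 + a * \<rho>p powr \<gamma> = \<rho>m * um^2 + a * \<rho>m powr \<gamma>"
    and R: "R = \<rho>p / \<rho>m"
  shows "R = um / up" and "R > 1"
    and "up\<^sup>2 / (a * \<gamma> * \<rho>p powr (\<gamma> - 1)) = (R powr \<gamma> - 1) / (\<gamma> * R powr \<gamma> * (R - 1))"
    and "up\<^sup>2 < a * \<gamma> * \<rho>p powr (\<gamma> - 1)" and "a * \<gamma> * \<rho>m powr (\<gamma> - 1) < um\<^sup>2"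
proof -
  show Ru: "R = um / up" using mass assms(3-6) by (simp add: R field_simps)
  show R1: "R > 1" unfolding Ru using assms(5,6) by simp
  have um: "um = R * up" using Ru assms(5) by simp
  have \<rho>p: "\<rho>p = R * \<rho>m" using R assms(4) by simp
  define y where "y = R powr \<gamma>"
  define q where "q = \<rho>m powr \<gamma>"
  have y: "y > 0" and q: "q > 0" using R1 assms by (simp_all add: y_def q_def)
  have pp: "\<rho>p powr \<gamma> = y * q"
    unfolding \<rho>p y_def q_def using R1 assms(4) by (simp add: powr_mult)
  have pp1: "\<rho>p powr (\<gamma> - 1) = y * q / (R * \<rho>m)" "\<rho>m powr (\<gamma> - 1) = q / \<rho>m"
    using assms(3,4) by (simp_all add: powr_diff pp q_def flip: \<rho>p)
  \<comment> \<open>The momentum balance with \<open>um\<close> and \<open>\<rho>p\<close>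
    eliminated in favour of \<open>R\<close>: pressure jump equals mass flux times velocity
    drop.\<close>
  have jump: "a * q * (y - 1) = \<rho>m * R * up\<^sup>2 * (R - 1)"
    using mom unfolding pp q_def[symmetric] unfolding um \<rho>p by (simp add: algebra_simps power2_eq_square)
  have lnR: "\<gamma> * ln R > 0" using assms R1 by simp
  have "ln R < R - 1" using R1 by (rule ln_less_self_minus_1)
  have ly: "ln y = \<gamma> * ln R" using R1 by (simp add: y_def ln_powr)
  have "- \<gamma> * ln R \<le> 1 / y - 1"
    using ln_le_minus_one[of "1 / y"] y ly by (simp add: ln_div)
  moreover have "\<gamma> * ln R < \<gamma> * (R - 1)" using \<open>ln R < R - 1\<close> assms by simp
  ultimately have "1 - 1 / y < \<gamma> * (R - 1)" by linarith
  then have upper: "y - 1 < y * \<gamma> * (R - 1)" using y by (simp add: field_simps)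
  have "ln R > 1 - 1 / R"
    using ln_le_minus_one[of "1 / R"] ln_eq_minus_one[of "1 / R"] R1 by (fastforce simp: ln_div)
  then have "\<gamma> * (1 - 1 / R) < \<gamma> * ln R" using assms by simp
  moreover have "\<gamma> * ln R \<le> y - 1" using ln_le_minus_one[of y] y ly by simp
  ultimately have "\<gamma> * (1 - 1 / R) < y - 1" by linarith
  then have lower: "\<gamma> * (R - 1) < R * (y - 1)" using R1 by (simp add: field_simps)
  have aq: "a * q > 0" using assms q by simp
  show "up\<^sup>2 / (a * \<gamma> * \<rho>p powr (\<gamma> - 1)) = (R powr \<gamma> - 1) / (\<gamma> * R powr \<gamma> * (R - 1))"
  proof -
    have nz: "a * \<gamma> * (y * q / (R * \<rho>m)) \<noteq> 0" "\<gamma> * y * (R - 1) \<noteq> 0"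
      using assms y q R1 by auto
    obtain d where d: "d = R * \<rho>m" by simp
    have "up\<^sup>2 * (\<gamma> * y * (R - 1)) * d = (y - 1) * (a * \<gamma> * (y * q))"
      using jump unfolding d by algebra
    moreover have "d \<noteq> 0" unfolding d using R1 assms(4) by simp
    ultimately show ?thesis
      unfolding pp1 y_def[symmetric] unfolding frac_eq_eq[OF nz] unfolding d[symmetric]
      by (simp add: field_simps)
  qed
  have "\<rho>m * R * up\<^sup>2 * (R - 1) < a * q * (y * \<gamma> * (R - 1))"
    unfolding jump[symmetric] by (rule mult_strict_left_mono[OF upper aq])
  then have "(\<rho>m * R * up\<^sup>2) * (R - 1) < (a * \<gamma> * y * q) * (R - 1)" by (simp add: algebra_simps)
  then have "\<rho>m * R * up\<^sup>2 < a * \<gamma> * y * q" using R1 by (simp only: mult_less_cancel_right)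
  then show "up\<^sup>2 < a * \<gamma> * \<rho>p powr (\<gamma> - 1)"
    unfolding pp1 using R1 assms(4) by (simp add: field_simps)
  have "a * q * (\<gamma> * (R - 1)) < a * q * (R * (y - 1))"
    by (rule mult_strict_left_mono[OF lower aq])
  also have "\<dots> = R * (\<rho>m * R * up\<^sup>2 * (R - 1))" unfolding jump[symmetric] by simp
  finally have "(a * q * \<gamma>) * (R - 1) < (\<rho>m * (R * up)\<^sup>2) * (R - 1)"
    by (simp add: algebra_simps power2_eq_square)
  then have "a * q * \<gamma> < \<rho>m * (R * up)\<^sup>2" using R1 by (simp only: mult_less_cancel_right)
  then show "a * \<gamma> * \<rho>m powr (\<gamma> - 1) < um\<^sup>2"
    unfolding pp1 um using assms(4) by (simp add: field_simps)
qed

lemma ex_lopatinsky_root_expansion: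
  fixes \<gamma> a \<beta> \<rho>p \<rho>m up um R M lam2 :: real
  assumes "\<gamma> \<ge> 1" and "a > 0" and "\<beta> > 0" and "\<rho>p > 0" and "\<rho>m > 0" and "0 < up" and "up < um"
    and mass: "\<rho>p * up = \<rho>m * um"
    and mom: "\<rho>p * up^2 + a * \<rho>p powr \<gamma> = \<rho>m * um^2 + a * \<rho>m powr \<gamma>"
    and R: "R = \<rho>p / \<rho>m"
    and M: "M > 0" "M^2 = up^2 / (a * \<gamma> * \<rho>p powr (\<gamma> - 1))"
    and lam2: "lam2 = (R - 1) * M * R^2 * \<rho>m * up^3 / (2 * (M + 1))"
  obtains K lam where "lam2 > 0" and "\<forall>\<^sub>F \<epsilon> in at_right 0. \<bar>lam \<epsilon> - lam2 * \<epsilon>\<^sup>2\<bar> \<le> K * \<epsilon> ^ 4 \<and>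
     slow_field \<rho>m um (1 / \<epsilon>) \<and>
     lopatinsky_root a \<gamma> \<beta> (parallel_state \<rho>m um (1 / \<epsilon>)) (parallel_state \<rho>p up (1 / \<epsilon>))
       (complex_of_real (lam \<epsilon>)) 1"
proof -
  note gas = gas_shock_facts[OF assms(1,2,4-7) mass mom R]
  \<comment> \<open>\<open>M\<close> is the Mach number on the right, so this is the sound speed
    there.\<close>
  define c where "c = up / M"
  define Cm where "Cm = a * \<gamma> * \<rho>m powr (\<gamma> - 1)"
  have c: "c > 0" using M assms by (simp add: c_def)
  have c2: "c\<^sup>2 = a * \<gamma> * \<rho>p powr (\<gamma> - 1)"
    unfolding c_def power_divide M(2) using assms by simp
  have sub: "up < c"
    by (rule power_less_imp_less_base[of _ 2]) (use gas(4) c c2 in auto)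
  have Cm: "0 < Cm" "Cm < um\<^sup>2" using gas(5) assms by (simp_all add: Cm_def)
  have dp: "pressure a \<gamma> \<rho>p - pressure a \<gamma> \<rho>m = \<rho>p * up * (um - up)"
  proof -
    have "\<rho>m * um\<^sup>2 = \<rho>p * up * um" by (simp add: mass power2_eq_square)
    then show ?thesis using mom by (simp add: pressure_def algebra_simps power2_eq_square)
  qed
  have pos: "lam2 > 0" using lam2 gas(2) M assms by simp
  have lam2': "lam2 = (\<rho>p * up * (um - up))\<^sup>2 / (2 * (\<rho>p - \<rho>m) * (up + c))"
  proof -
    have um: "um = R * up" using gas(1) assms(6) by simp
    have \<rho>p: "\<rho>p = R * \<rho>m" using R assms(5) by simp
    have eq: "up + c = up * (M + 1) / M" using M by (simp add: c_def field_simps)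
    have eq2: "\<rho>p * up * (um - up) = \<rho>m * R * up\<^sup>2 * (R - 1)" "\<rho>p - \<rho>m = \<rho>m * (R - 1)"
      unfolding um \<rho>p by (simp_all add: algebra_simps power2_eq_square)
    have "(d * R * v\<^sup>2 * r)\<^sup>2 / (2 * (d * r) * (v * k / M)) = r * M * R\<^sup>2 * d * v ^ 3 / (2 * k)"
      if "d \<noteq> 0" "r \<noteq> 0" "v \<noteq> 0" "k \<noteq> 0" for d r v k :: real
      using that M(1) by (simp add: field_simps power2_eq_square power3_eq_cube)
    from this[of \<rho>m "R - 1" up "M + 1"] show ?thesis
      unfolding eq eq2 lam2 using gas(2) M(1) assms(5,6) by simp
  qed
  obtain K where K: "\<forall>\<^sub>F e in at_right 0. \<exists>l. \<bar>l - lam2\<bar> \<le> K * e \<and>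
    (\<forall>h. h\<^sup>2 = 1 / e \<longrightarrow> \<rho>m * um\<^sup>2 < h\<^sup>2 \<and>
      lopatinsky_root a \<gamma> \<beta> (parallel_state \<rho>m um h) (parallel_state \<rho>p up h) (complex_of_real (e * l)) 1)"
    using lopatinsky_roots_near[OF assms(4-7,3) c c2 sub Cm_def Cm mass dp lam2' pos] .
  \<comment> \<open>The branch is parametrized by \<open>e = \<epsilon>\<^sup>2\<close>; convergence
    together with positivity of the square allows the substitution in
    \<open>at_right 0\<close>.\<close>
  have "((\<lambda>\<epsilon>::real. \<epsilon>\<^sup>2) \<longlongrightarrow> 0) (at_right 0)"
    by (rule tendsto_eq_intros refl | simp)+
  moreover have "\<forall>\<^sub>F \<epsilon> :: real in at_right 0. \<epsilon>\<^sup>2 \<in> {0<..} \<and> \<epsilon>\<^sup>2 \<noteq> 0"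
    using eventually_at_right_less[of "0::real"] by (rule eventually_mono) simp
  ultimately have "filterlim (\<lambda>\<epsilon>::real. \<epsilon>\<^sup>2) (at_right 0) (at_right 0)"
    by (simp add: filterlim_at)
  note K2 = eventually_conj[OF eventually_compose_filterlim[OF K this] eventually_at_right_less[of "0::real"]]
  define P where "P = (\<lambda>\<epsilon> l. \<bar>l - lam2\<bar> \<le> K * \<epsilon>\<^sup>2 \<and> slow_field \<rho>m um (1 / \<epsilon>) \<and>
     lopatinsky_root a \<gamma> \<beta> (parallel_state \<rho>m um (1 / \<epsilon>)) (parallel_state \<rho>p up (1 / \<epsilon>))
       (complex_of_real (\<epsilon>\<^sup>2 * l)) 1)"
  have "\<forall>\<^sub>F \<epsilon> in at_right 0. \<exists>l. P \<epsilon> l"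
    using K2
  proof (rule eventually_mono, elim conjE exE)
    fix \<epsilon> l
    assume \<epsilon>: "0 < \<epsilon>" and close: "\<bar>l - lam2\<bar> \<le> K * \<epsilon>\<^sup>2" and
      root: "\<forall>h. h\<^sup>2 = 1 / \<epsilon>\<^sup>2 \<longrightarrow> \<rho>m * um\<^sup>2 < h\<^sup>2 \<and>
      lopatinsky_root a \<gamma> \<beta> (parallel_state \<rho>m um h) (parallel_state \<rho>p up h) (complex_of_real (\<epsilon>\<^sup>2 * l)) 1"
    have h: "(1 / \<epsilon>)\<^sup>2 = 1 / \<epsilon>\<^sup>2" by (simp add: power_divide)
    have "(um * sqrt \<rho>m)\<^sup>2 < \<bar>1 / \<epsilon>\<bar>\<^sup>2"
      using root[rule_format, OF h] assms(5) \<epsilon> by (simp add: power_mult_distrib mult.commute)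
    then have "slow_field \<rho>m um (1 / \<epsilon>)"
      unfolding slow_field_def by (rule power2_less_imp_less) simp
    then show "\<exists>l. P \<epsilon> l"
      using root[rule_format, OF h] close unfolding P_def by blast
  qed
  \<comment> \<open>The root is selected independently for each \<epsilon>. The expansion rests on
    the uniform bound alone, not on regularity in \<epsilon>.\<close>
  then have ev: "\<forall>\<^sub>F \<epsilon> in at_right 0. P \<epsilon> (SOME l. P \<epsilon> l)"
    by (rule eventually_mono) (rule someI_ex)
  show thesis
  proof (rule that[OF pos, of "\<lambda>\<epsilon>. \<epsilon>\<^sup>2 * (SOME l. P \<epsilon> l)" K], rule eventually_mono[OF ev])
    fix \<epsilon>
    define l where "l = (SOME l. P \<epsilon> l)"
    assume "P \<epsilon> (SOME l. P \<epsilon> l)"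
    then have l: "P \<epsilon> l" by (simp add: l_def)
    have "\<epsilon>\<^sup>2 * l - lam2 * \<epsilon>\<^sup>2 = \<epsilon>\<^sup>2 * (l - lam2)" by (simp add: algebra_simps)
    then have "\<bar>\<epsilon>\<^sup>2 * l - lam2 * \<epsilon>\<^sup>2\<bar> = \<epsilon>\<^sup>2 * \<bar>l - lam2\<bar>" by (simp add: abs_mult)
    also have "\<dots> \<le> \<epsilon>\<^sup>2 * (K * \<epsilon>\<^sup>2)"
      using l by (intro mult_left_mono) (simp_all add: P_def)
    also have "\<dots> = K * \<epsilon> ^ 4"
      by (simp add: power2_eq_square power4_eq_xxxx)
    finally show "\<bar>\<epsilon>\<^sup>2 * (SOME l. P \<epsilon> l) - lam2 * \<epsilon>\<^sup>2\<bar> \<le> K * \<epsilon> ^ 4 \<and> slow_field \<rho>m um (1 / \<epsilon>) \<and>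
     lopatinsky_root a \<gamma> \<beta> (parallel_state \<rho>m um (1 / \<epsilon>)) (parallel_state \<rho>p up (1 / \<epsilon>))
       (complex_of_real (\<epsilon>\<^sup>2 * (SOME l. P \<epsilon> l))) 1"
      unfolding l_def[symmetric] using l by (simp add: P_def)
  qed
qed


theorem mainTheorem1:
  fixes \<gamma> a \<beta> \<rho>p \<rho>m up um R M lam2 :: real
  assumes "\<gamma> \<ge> 1" and "a > 0" and "\<beta> > 0"
    and "\<rho>p > 0" and "\<rho>m > 0"
    and "0 < up" and "up < um"
    and "\<rho>p * up = \<rho>m * um"
    and "\<rho>p * up^2 + a * \<rho>p powr \<gamma> = \<rho>m * um^2 + a * \<rho>m powr \<gamma>"
    and "R = \<rho>p / \<rho>m"
    and "M > 0" and "M^2 = up^2 / (a * \<gamma> * \<rho>p powr (\<gamma> - 1))"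
    and "lam2 = (R - 1) * M * R^2 * \<rho>m * up^3 / (2 * (M + 1))"
  shows "R = um / up \<and> R > 1 \<and> M^2 = (R powr \<gamma> - 1) / (\<gamma> * R powr \<gamma> * (R - 1)) \<and> lam2 > 0
    \<and> (\<exists>lam :: real \<Rightarrow> complex.
          (\<forall>\<^sub>F \<epsilon> in at_right 0.
             slow_field \<rho>m um (1 / \<epsilon>) \<and>
             lopatinsky_root a \<gamma> \<beta> (parallel_state \<rho>m um (1 / \<epsilon>)) (parallel_state \<rho>p up (1 / \<epsilon>))
               (lam \<epsilon>) 1)
          \<and> (\<lambda>\<epsilon>. lam \<epsilon> - complex_of_real (lam2 * \<epsilon>^2)) \<in> O[at_right 0](\<lambda>\<epsilon>. complex_of_real (\<epsilon>^3)))
    \<and> (\<exists>H. \<forall>h\<ge>H.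
          slow_field \<rho>m um h \<and>
          (\<exists>lam. 0 < Re lam \<and>
             lopatinsky_root a \<gamma> \<beta> (parallel_state \<rho>m um h) (parallel_state \<rho>p up h) lam 1))"
proof -
  note gas = gas_shock_facts[OF assms(1,2,4-10)]
  obtain K lam where pos: "lam2 > 0" and ev: "\<forall>\<^sub>F \<epsilon> in at_right 0. \<bar>lam \<epsilon> - lam2 * \<epsilon>\<^sup>2\<bar> \<le> K * \<epsilon> ^ 4 \<and>
     slow_field \<rho>m um (1 / \<epsilon>) \<and>
     lopatinsky_root a \<gamma> \<beta> (parallel_state \<rho>m um (1 / \<epsilon>)) (parallel_state \<rho>p up (1 / \<epsilon>))
       (complex_of_real (lam \<epsilon>)) 1"
    using ex_lopatinsky_root_expansion[OF assms] .
  have "(\<lambda>\<epsilon>. complex_of_real (lam \<epsilon>) - complex_of_real (lam2 * \<epsilon>^2)) \<in> O[at_right 0](\<lambda>\<epsilon>. complex_of_real (\<epsilon>^3))"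
  \<comment> \<open>For \<epsilon> below 1 the fourth-power error is absorbed by
    \<open>\<epsilon>^3\<close>; the absolute value is taken since no sign of \<open>K\<close> is
    known.\<close>
  proof (rule bigoI[where c = "\<bar>K\<bar>"])
    have "\<forall>\<^sub>F \<epsilon> :: real in at_right 0. 0 < \<epsilon> \<and> \<epsilon> < 1"
      using eventually_at_right_less[of "0::real"] eventually_at_right_real[of 0 1]
      by (auto elim: eventually_mono)
    with ev show "\<forall>\<^sub>F \<epsilon> in at_right 0. norm (complex_of_real (lam \<epsilon>) - complex_of_real (lam2 * \<epsilon>^2))
        \<le> \<bar>K\<bar> * norm (complex_of_real (\<epsilon>^3))"
    proof eventually_elim
      case (elim \<epsilon>)
      have "norm (complex_of_real (lam \<epsilon>) - complex_of_real (lam2 * \<epsilon>^2)) = \<bar>lam \<epsilon> - lam2 * \<epsilon>\<^sup>2\<bar>"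
        unfolding of_real_diff[symmetric] by (rule norm_of_real)
      also have "\<dots> \<le> K * \<epsilon> ^ 4" using elim by simp
      also have "\<dots> \<le> \<bar>K\<bar> * \<epsilon> ^ 3"
        using elim by (intro mult_mono power_decreasing) auto
      finally show ?case using elim by (simp add: norm_power)
    qed
  qed
  moreover have "\<exists>H. \<forall>h\<ge>H. slow_field \<rho>m um h \<and>
      (\<exists>lam. 0 < Re lam \<and>
        lopatinsky_root a \<gamma> \<beta> (parallel_state \<rho>m um h) (parallel_state \<rho>p up h) lam 1)"
  proof -
    obtain b where b: "b > 0" "\<And>\<epsilon>. 0 < \<epsilon> \<Longrightarrow> \<epsilon> < b \<Longrightarrow> slow_field \<rho>m um (1 / \<epsilon>) \<and>
     lopatinsky_root a \<gamma> \<beta> (parallel_state \<rho>m um (1 / \<epsilon>)) (parallel_state \<rho>p up (1 / \<epsilon>))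
       (complex_of_real (lam \<epsilon>)) 1"
      using ev unfolding eventually_at_right_field by blast
    show ?thesis
    \<comment> \<open>The added 1 turns \<open>h \<ge> H\<close> into \<open>h > 1 / b\<close>, so
      that \<open>1 / h\<close> lies strictly below \<open>b\<close>.\<close>
    proof (intro exI[of _ "1 / b + 1"] allI impI)
      fix h assume h: "1 / b + 1 \<le> h"
      have "1 / b > 0" using b(1) by simp
      then have "h > 1 / b" "h > 0" using h by linarith+
      then have "0 < 1 / h" "1 / h < b" using b(1) by (simp_all add: field_simps)
      from b(2)[OF this] have root: "slow_field \<rho>m um h"
        "lopatinsky_root a \<gamma> \<beta> (parallel_state \<rho>m um h) (parallel_state \<rho>p up h) (complex_of_real (lam (1 / h))) 1"
        by simp_all
      then have "0 < Re (complex_of_real (lam (1 / h)))" by (simp only: lopatinsky_root_def Let_def)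
      with root show "slow_field \<rho>m um h \<and> (\<exists>lam. 0 < Re lam \<and>
        lopatinsky_root a \<gamma> \<beta> (parallel_state \<rho>m um h) (parallel_state \<rho>p up h) lam 1)"
        by blast
    qed
  qed
  moreover have "M^2 = (R powr \<gamma> - 1) / (\<gamma> * R powr \<gamma> * (R - 1))"
    using gas(3) assms(12) by simp
  ultimately show ?thesis
    using gas(1,2) pos eventually_mono[OF ev] by (intro conjI exI[of _ "\<lambda>\<epsilon>. complex_of_real (lam \<epsilon>)"]) auto
qed

end
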